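(* Let $n$ be a non-negative integer, let $a\in\mathbb{C}$ with $a\neq 0$, and write $x=u+au^{-1}$ with $u\neq 0$ and $u^2\neq a$. Consider the differential equation $$(x^2-4a)\,F_n''(x,a)+3x\,F_n'(x,a)-n^2F_n(x,a)=2n\,D_n(x,a),\qquad ( * )$$ which is satisfied by the $n$-th Dickson polynomial of the third kind $F_n(x,a)$, where $D_n(x,a)$ is the $n$-th Dickson polynomial of the first kind. Let $F_c(x,a)$ and $F_p(x,a)$ be the general solution to the associated homogeneous equation of $( * )$ and the particular solution of $( * )$, respectively. Then $$F_c(x,a)=\frac{1}{\sqrt[4]{x^2-4a}}\left[A\,P^{(\frac12)}_{\sqrt{n^2+1}-\frac12}\!\left(\frac{x}{2\sqrt a}\right)+B\,Q^{(\frac12)}_{\sqrt{n^2+1}-\frac12}\!\left(\frac{x}{2\sqrt a}\right)\right],$$ where $A$ and $B$ are constants, and $P^{(\frac12)}_{\sqrt{n^2+1}-\frac12}$ and $Q^{(\frac12)}_{\sqrt{n^2+1}-\frac12}$ are the associated Legendre functions of the first and second kinds, respectively. Also, $$F_p(x,a)=\sum_{k=0}^{n}b_k\,x^k,$$ where - if $n$ is odd and $k$ is even, or $n$ is even and $k$ is odd, $$b_{k+2}=-\left(\frac{n^2-k(k+2)}{4a(k+2)(k+1)}\right)b_k;$$ - otherwise, $$b_{k+2}=\frac{1}{4a(k+2)(k+1)}\Big\{[k(k+2)-n^2]\,b_k-2n\,\big(\text{coefficient of }x^{n-2i}\text{ in }D_n(x,a)\big)\Big\},$$ where $i=\frac{n-k}{2}$.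 In particular, $$F_n(x,a)=F_c(x,a)+F_p(x,a).$$
   Context: For a non-negative integer $n$ and $a\in\mathbb{C}$, the $n$-th Dickson polynomials of the first and third kinds are, respectively, $$D_n(x,a)=\sum_{i=0}^{\lfloor n/2\rfloor}\frac{n}{n-i}\binom{n-i}{i}(-a)^i x^{n-2i},\qquad F_n(x,a)=\sum_{i=0}^{\lfloor n/2\rfloor}\frac{n-2i}{n-i}\binom{n-i}{i}(-a)^i x^{n-2i}.$$ Primes denote derivatives with respect to $x$. The associated homogeneous equation of $( * )$ is $(x^2-4a)F''+3xF'-n^2F=0$. The associated Legendre functions of the first and second kinds, $P_l^{(m)}$ and $Q_l^{(m)}$, of degree $l$ and order $m$, are the standard pair of solutions of the associated Legendre equation $$(z^2-1)\frac{d^2u}{dz^2}+2z\frac{du}{dz}-\left[l(l+1)+\frac{m^2}{z^2-1}\right]u=0,$$ whose general solution is $c_1P_l^{(m)}(z)+c_2Q_l^{(m)}(z)$ with $c_1,c_2$ arbitrary constants; here $l=\sqrt{n^2+1}-\frac12$ and $m=\frac12$. *)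

theory Defs
  imports "HOL-Complex_Analysis.Complex_Analysis"
begin

text \<open>
  The sum for \<open>D_n\<close> reads \<open>0/0\<close> at \<open>n = 0\<close>; the usual convention is \<open>D_0 = 2\<close>.  For \<open>F_n\<close> the
  corresponding convention is \<open>F_0 = 0\<close>, which \<open>0/0 = 0\<close> already gives.
\<close>

definition dickson1 :: "nat \<Rightarrow> complex \<Rightarrow> complex poly" where
  "dickson1 n a = (if n = 0 then [:2:] else
     (\<Sum>i\<le>n div 2. monom (of_nat n / of_nat (n - i) * of_nat ((n - i) choose i) * (- a) ^ i) (n - 2 * i)))"

definition dickson3 :: "nat \<Rightarrow> complex \<Rightarrow> complex poly" where
  "dickson3 n a =
     (\<Sum>i\<le>n div 2. monom (of_nat (n - 2 * i) / of_nat (n - i) * of_nat ((n - i) choose i) * (- a) ^ i) (n - 2 * i))"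

definition dickson_domain :: "complex \<Rightarrow> complex set" where
  "dickson_domain a = {u + a / u | u. u \<noteq> 0 \<and> u\<^sup>2 \<noteq> a}"

definition solves_ode_with_rhs ::
    "nat \<Rightarrow> complex \<Rightarrow> (complex \<Rightarrow> complex) \<Rightarrow> complex set \<Rightarrow> (complex \<Rightarrow> complex) \<Rightarrow> bool" where
  "solves_ode_with_rhs n a g U F \<longleftrightarrow> F holomorphic_on U \<and>
     (\<forall>x\<in>U. (x\<^sup>2 - 4 * a) * deriv (deriv F) x + 3 * x * deriv F x - (of_nat n)\<^sup>2 * F x = g x)"

abbreviation solves_dickson_ode :: "nat \<Rightarrow> complex \<Rightarrow> complex set \<Rightarrow> (complex \<Rightarrow> complex) \<Rightarrow> bool" where
  "solves_dickson_ode n a \<equiv> solves_ode_with_rhs n a (\<lambda>x. 2 * of_nat n * poly (dickson1 n a) x)"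

abbreviation solves_homogeneous_ode :: "nat \<Rightarrow> complex \<Rightarrow> complex set \<Rightarrow> (complex \<Rightarrow> complex) \<Rightarrow> bool" where
  "solves_homogeneous_ode n a \<equiv> solves_ode_with_rhs n a (\<lambda>x. 0)"

text \<open>
  The principal branch of the Gauss hypergeometric function: the analytic continuation of the
  hypergeometric series to the plane cut along \<open>[1, \<infinity>)\<close> (for \<open>c\<close> not a non-positive integer).
  Values on the cut are meaningless.
\<close>

definition hyp2F1 :: "complex \<Rightarrow> complex \<Rightarrow> complex \<Rightarrow> complex \<Rightarrow> complex" where
  "hyp2F1 a b c = (SOME f. f holomorphic_on (- (of_real ` {1..})) \<and>
     (\<forall>w\<in>ball 0 1. f w = eval_fps (fps_hypergeo [a, b] [c] 1) w))"

text \<open>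
  The associated Legendre functions of degree \<open>\<nu>\<close> and order \<open>\<mu>\<close> in the plane cut along \<open>(-\<infinity>, 1]\<close>,
  with the classical (Hobson) normalisation, for \<open>1 - \<mu>\<close> and \<open>\<nu> + 3/2\<close> not non-positive integers.
  The power \<open>(z^2 - 1) powr (\<mu>/2)\<close> in the second kind function is the branch which is
  continuous on the cut plane and principal for \<open>z > 1\<close>, whence the two factors.
\<close>

definition legendre_cut_plane :: "complex set" where
  "legendre_cut_plane = - (of_real ` {..1})"

definition legendreP :: "complex \<Rightarrow> complex \<Rightarrow> complex \<Rightarrow> complex" where
  "legendreP \<nu> \<mu> z = 1 / Gamma (1 - \<mu>) * ((z + 1) / (z - 1)) powr (\<mu> / 2) *
     hyp2F1 (- \<nu>) (\<nu> + 1) (1 - \<mu>) ((1 - z) / 2)"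

definition legendreQ :: "complex \<Rightarrow> complex \<Rightarrow> complex \<Rightarrow> complex" where
  "legendreQ \<nu> \<mu> z = exp (\<mu> * of_real pi * \<i>) * of_real (sqrt pi) * Gamma (\<nu> + \<mu> + 1) /
     (2 powr (\<nu> + 1) * Gamma (\<nu> + 3 / 2)) *
     ((z - 1) powr (\<mu> / 2) * (z + 1) powr (\<mu> / 2)) / z powr (\<nu> + \<mu> + 1) *
     hyp2F1 ((\<nu> + \<mu> + 2) / 2) ((\<nu> + \<mu> + 1) / 2) (\<nu> + 3 / 2) (1 / z\<^sup>2)"

text \<open>
  Both functions are multivalued on the plane without \<open>1\<close> and \<open>-1\<close>.  \<open>legendre_branch \<nu> \<mu> P Q T\<close>
  states that \<open>P\<close> and \<open>Q\<close> on the domain \<open>T\<close> arise from the above pair by simultaneous analytic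
  continuation along a chain of domains (the two functions have to be continued along the
  same chain, since otherwise the pair may become linearly dependent).
\<close>

inductive legendre_branch ::
    "complex \<Rightarrow> complex \<Rightarrow> (complex \<Rightarrow> complex) \<Rightarrow> (complex \<Rightarrow> complex) \<Rightarrow> complex set \<Rightarrow> bool"
  for \<nu> \<mu> where
  principal: "legendre_branch \<nu> \<mu> (legendreP \<nu> \<mu>) (legendreQ \<nu> \<mu>) legendre_cut_plane"
| continue: "legendre_branch \<nu> \<mu> P Q S \<Longrightarrow> open T \<Longrightarrow> connected T \<Longrightarrow>
    P' holomorphic_on T \<Longrightarrow> Q' holomorphic_on T \<Longrightarrow>
    open V \<Longrightarrow> V \<noteq> {} \<Longrightarrow> V \<subseteq> S \<inter> T \<Longrightarrow> (\<And>z. z \<in> V \<Longrightarrow> P' z = P z \<and> Q' z = Q z) \<Longrightarrow>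
    legendre_branch \<nu> \<mu> P' Q' T"

text \<open>
  The recurrence between the coefficients of a particular solution of degree at most \<open>n\<close>; it is
  used with \<open>b k = 0\<close> for \<open>k > n\<close>, so that the cases \<open>k = n - 1\<close> and \<open>k = n\<close> fix \<open>b (n - 1)\<close>
  and, for \<open>n > 0\<close>, \<open>b n\<close>.
\<close>

definition dickson3_recurrence :: "nat \<Rightarrow> complex \<Rightarrow> (nat \<Rightarrow> complex) \<Rightarrow> bool" where
  "dickson3_recurrence n a b \<longleftrightarrow> (\<forall>k\<le>n. b (k + 2) =
     (if odd n \<and> even k \<or> even n \<and> odd k
      then - (((of_nat n)\<^sup>2 - of_nat (k * (k + 2))) / (4 * a * of_nat ((k + 2) * (k + 1)))) * b k
      else (let i = (n - k) div 2 in
        1 / (4 * a * of_nat ((k + 2) * (k + 1))) *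
          ((of_nat (k * (k + 2)) - (of_nat n)\<^sup>2) * b k
            - 2 * of_nat n * coeff (dickson1 n a) (n - 2 * i)))))"

end

theory Submission
  imports Defs
begin

text \<open>
  One has \<open>n F\<^sub>n = x D\<^sub>n'\<close>, so the equation for \<open>F\<^sub>n\<close> reduces to the second-order equation of
  \<open>D\<^sub>n\<close>, which is a two-term recurrence for coefficients; comparing coefficients also turns the
  equation for polynomial solutions into the stated recurrence and bounds their degree by \<open>n\<close>.

  The substitution \<open>x = 2 s z\<close>, \<open>F = G(z) / (x\<^sup>2 - 4 a)\<^bsup>1/4\<^esup>\<close> turns the homogeneous equation into the Legendre
  equation of order \<open>1/2\<close>.  Its solutions are elementary: with \<open>z = cosh \<theta>\<close> and \<open>c = \<nu> + 1/2\<close> they are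
  spanned by \<open>exp (\<plusminus>c \<theta>) / sqrt (sinh \<theta>)\<close>.  The two hypergeometric functions in the definition of
  \<open>P\<close> and \<open>Q\<close> are found in closed form, so that \<open>(z\<^sup>2 - 1) W(P, Q)\<close> is a nonzero constant on the cut plane.
  The differential equations and this Wronskian identity survive analytic continuation, and hence hold
  for every simultaneous branch.  Any solution is then a combination of the two with coefficients given
  by quotients of Wronskians, which are constant on a connected set.
\<close>

subsection \<open>Polynomial solutions\<close>

text \<open>The degree is forced by the substitution: splitting off the fourth root turns the
  constant \<open>n^2\<close> into \<open>n^2 + 3/4\<close> and leaves \<open>1/4\<close> over
  \<open>z^2 - 1\<close>. Hence \<open>\<mu> = 1/2\<close>, and
  \<open>\<nu> (\<nu> + 1) = c^2 - 1/4\<close> gives \<open>c^2 = n^2 + 1\<close>. So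
  \<open>c > 0\<close> even for \<open>n = 0\<close>, and the exponentials for \<open>c\<close> and
  \<open>- c\<close> are always independent.

  Two obstacles shape the analytic part. First, \<open>hyp2F1\<close> is a choice among functions on
  a slit plane; nothing is known about it until one holomorphic function there with the right power
  series is exhibited. The closed forms supply this existence, and the identity theorem supplies
  uniqueness. Secondly, the domain of a branch is arbitrary: nothing in its definition keeps it away
  from \<open>1\<close> and \<open>-1\<close> or makes it simply connected. Therefore the Legendre
  equation is used with denominators cleared, the Wronskian is recorded as an identity with an
  explicit constant, and solutions are compared through quotients of Wronskians, which require no
  primitive.\<close>

lemma coeff_sum_monom_parity:
  fixes f :: "nat \<Rightarrow> 'a::comm_monoid_add"
  shows "coeff (\<Sum>i\<le>n div 2. monom (f i) (n - 2 * i)) k =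
    (if k \<le> n \<and> even (n - k) then f ((n - k) div 2) else 0)"
proof -
  have "coeff (\<Sum>i\<le>n div 2. monom (f i) (n - 2 * i)) k = (\<Sum>i\<le>n div 2. if n - 2 * i = k then f i else 0)"
    by (simp add: coeff_sum)
  \<comment> \<open>In this range \<open>n - 2 * i\<close> does not truncate, so the exponents are
    distinct and at most one index survives.\<close>
  also have "\<dots> = (\<Sum>i\<le>n div 2. if i = (n - k) div 2 \<and> k \<le> n \<and> even (n - k) then f i else 0)"
  proof (rule sum.cong[OF refl])
    fix i assume "i \<in> {..n div 2}"
    then have i: "2 * i \<le> n" by simp
    have "n - 2 * i = k \<longleftrightarrow> i = (n - k) div 2 \<and> k \<le> n \<and> even (n - k)"
    proof
      assume "n - 2 * i = k"
      with i have "n - k = 2 * i" "k \<le> n" by arith+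
      then show "i = (n - k) div 2 \<and> k \<le> n \<and> even (n - k)" by simp
    next
      assume "i = (n - k) div 2 \<and> k \<le> n \<and> even (n - k)"
      then have "2 * i = n - k" "k \<le> n" by auto
      then show "n - 2 * i = k" by arith
    qed
    then show "(if n - 2 * i = k then f i else 0) =
        (if i = (n - k) div 2 \<and> k \<le> n \<and> even (n - k) then f i else 0)"
      by simp
  qed
  also have "\<dots> = (if k \<le> n \<and> even (n - k) then f ((n - k) div 2) else 0)"
  proof (cases "k \<le> n \<and> even (n - k)")
    case True
    then show ?thesis by (simp add: div_le_mono)
  qed (auto intro!: sum.neutral)
  finally show ?thesis .
qed

lemma coeff_dickson1:
  assumes "n > 0"
  shows "coeff (dickson1 n a) k = (if k \<le> n \<and> even (n - k) then
    of_nat n / of_nat (n - (n - k) div 2) * of_nat ((n - (n - k) div 2) choose ((n - k) div 2)) *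
      (- a) ^ ((n - k) div 2) else 0)"
proof -
  have "dickson1 n a = (\<Sum>i\<le>n div 2.
      monom (of_nat n / of_nat (n - i) * of_nat ((n - i) choose i) * (- a) ^ i) (n - 2 * i))"
    using assms by (simp add: dickson1_def)
  then show ?thesis by (simp only: coeff_sum_monom_parity)
qed

lemma coeff_dickson1_eq_0:
  assumes "n > 0" and "k > n \<or> odd (n + k)"
  shows "coeff (dickson1 n a) k = 0"
  using assms by (auto simp: coeff_dickson1)

text \<open>The coefficients of the two polynomials differ only in the numerators \<open>n\<close>
  and \<open>n - 2 * i\<close>, and \<open>n - 2 * i\<close> is the exponent \<open>k\<close>; this
  is \<open>n F = x D'\<close> read off coefficientwise.\<close>

lemma coeff_dickson3:
  assumes "n > 0"
  shows "of_nat n * coeff (dickson3 n a) k = of_nat k * coeff (dickson1 n a) k"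
proof -
  have "n - 2 * ((n - k) div 2) = k" if "k \<le> n" "even (n - k)"
    using that by (simp add: dvd_mult_div_cancel)
  then show ?thesis
    using assms unfolding coeff_dickson1[OF assms] dickson3_def
      coeff_sum_monom_parity[where f = "\<lambda>i. of_nat (n - 2 * i) / of_nat (n - i) * of_nat ((n - i) choose i) * (- a) ^ i"]
    by auto
qed

text \<open>Multiplied by \<open>i! m!\<close> with \<open>m = n - 2 i - 2\<close>, both sides
  become \<open>(m + i + 2)!\<close>. This gives the ratio of consecutive coefficients of the
  first-kind polynomial.\<close>

lemma choose_shift_twice:
  assumes "2 * i + 2 \<le> n"
  shows "(n - 2 * i) * (n - 2 * i - 1) * ((n - i) choose i) = (n - i) * Suc i * ((n - Suc i) choose Suc i)"
proof -
  define m where "m = n - 2 * i - 2"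
  have n: "n = m + 2 * i + 2" using assms by (simp add: m_def)
  have "(m + i + 2 choose i) * fact i * fact (m + 2) = (fact (m + i + 2) :: nat)"
    using binomial_fact_lemma[of i "m + i + 2"] by (simp add: algebra_simps)
  then have 1: "(m + i + 2 choose i) * ((m + 2) * (m + 1)) * (fact i * fact m) = (m + i + 2) * (fact (m + i + 1) :: nat)"
    by (simp add: algebra_simps)
  have 2: "(m + i + 1 choose Suc i) * Suc i * (fact i * fact m) = (fact (m + i + 1) :: nat)"
    using binomial_fact_lemma[of "Suc i" "m + i + 1"] by (simp add: algebra_simps)
  have "(m + i + 2 choose i) * ((m + 2) * (m + 1)) * (fact i * fact m) =
      (m + i + 2) * ((m + i + 1 choose Suc i) * Suc i) * (fact i * fact m :: nat)"
    unfolding 1 2[symmetric] by (simp only: mult.assoc)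
  then have "(m + i + 2 choose i) * ((m + 2) * (m + 1)) = (m + i + 2) * ((m + i + 1 choose Suc i) * Suc i)"
    by (simp only: mult_cancel2) simp
  moreover have "n - 2 * i = m + 2" "n - 2 * i - 1 = m + 1" "n - i = m + i + 2" "n - Suc i = m + i + 1"
    using n by auto
  ultimately show ?thesis by (simp only: ac_simps)
qed

text \<open>Coefficient form of \<open>(x^2 - 4 a) D'' + x D' - n^2 D = 0\<close>, since
  \<open>k (k - 1) + k = k^2\<close>.\<close>

lemma coeff_dickson1_recurrence:
  assumes "n > 0"
  shows "4 * a * of_nat ((k + 2) * (k + 1)) * coeff (dickson1 n a) (k + 2) =
    ((of_nat k)\<^sup>2 - (of_nat n)\<^sup>2) * coeff (dickson1 n a) k"
proof (cases "k + 2 \<le> n \<and> even (n - k)")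
  case True
  then obtain j where j: "n - k = 2 * j" by blast
  define i where "i = j - 1"
  have i: "n = k + 2 * i + 2" using True j by (auto simp: i_def)
  have k: "n - (k + 2) = 2 * i" "n - k = 2 * Suc i" using i by auto
  have c: "of_nat ((k + 2) * (k + 1)) * (of_nat ((n - i) choose i) / of_nat (n - i)) =
      (of_nat (Suc i) * of_nat ((n - Suc i) choose Suc i) :: complex)"
  proof -
    have "(k + 2) * (k + 1) * ((n - i) choose i) = (n - i) * (Suc i * ((n - Suc i) choose Suc i))"
    proof -
      have "n - 2 * i = k + 2" "n - 2 * i - 1 = k + 1" "2 * i + 2 \<le> n" using i by auto
      with choose_shift_twice[of i n] show ?thesis by (simp only: mult.assoc)
    qed
    then have "of_nat ((k + 2) * (k + 1)) * of_nat ((n - i) choose i) =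
        (of_nat (n - i) * (of_nat (Suc i) * of_nat ((n - Suc i) choose Suc i)) :: complex)"
      by (metis of_nat_mult)
    moreover have "of_nat (n - i) \<noteq> (0::complex)" unfolding of_nat_eq_0_iff using i by simp
    ultimately show ?thesis
      by (simp add: nonzero_divide_eq_eq mult.commute mult.left_commute)
  qed
  \<comment> \<open>From \<open>n - k = 2 * Suc i\<close> follows
    \<open>n + k = 2 * (n - Suc i)\<close>, so this product contains the denominator of the
    coefficient of \<open>x^k\<close>.\<close>
  have 1: "(of_nat k)\<^sup>2 - (of_nat n)\<^sup>2 = (- 4 * of_nat (Suc i) * of_nat (n - Suc i) :: complex)"
    using i by (simp add: algebra_simps power2_eq_square)
  have 2: "of_nat (n - Suc i) \<noteq> (0::complex)" unfolding of_nat_eq_0_iff using i by simp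
  have d2: "coeff (dickson1 n a) (k + 2) = of_nat n * (of_nat ((n - i) choose i) / of_nat (n - i)) * (-a)^i"
    unfolding coeff_dickson1[OF assms] k using True by simp
  have 3: "coeff (dickson1 n a) k =
      of_nat n / of_nat (n - Suc i) * of_nat ((n - Suc i) choose Suc i) * (-a)^Suc i"
    unfolding coeff_dickson1[OF assms] k using True by simp
  have "K * d = - 4 * N * (I * C) * e" if "K = - 4 * I * M" "M \<noteq> 0" "d = N / M * C * e"
    for K I M N C d e :: complex
    using that by (simp add: field_simps)
  from this[OF 1 2 3] have r: "((of_nat k)\<^sup>2 - (of_nat n)\<^sup>2) * coeff (dickson1 n a) k =
      - 4 * of_nat n * (of_nat (Suc i) * of_nat ((n - Suc i) choose Suc i)) * (-a)^Suc i" .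
  show ?thesis
    unfolding r c[symmetric] d2 by (simp add: ac_simps)
next
  case False
  then have "coeff (dickson1 n a) (k + 2) = 0" using assms by (auto simp: coeff_dickson1)
  \<comment> \<open>At \<open>k = n\<close> the factor \<open>k^2 - n^2\<close> vanishes instead of
    the coefficient; \<open>k = n - 1\<close> is excluded by parity.\<close>
  moreover have "k = n \<or> coeff (dickson1 n a) k = 0"
  proof (rule disjCI)
    assume "coeff (dickson1 n a) k \<noteq> 0"
    then have "k \<le> n" "even (n - k)" using assms by (auto simp: coeff_dickson1 split: if_splits)
    with False have "n < k + 2" "k \<le> n" "even (n - k)" by auto
    then show "k = n" by (cases "n = k + 1") auto
  qed
  ultimately show ?thesis by auto
qed

section \<open>The differential operator on polynomials\<close>

definition dickson_operator :: "nat \<Rightarrow> complex \<Rightarrow> complex poly \<Rightarrow> complex poly" where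
  "dickson_operator n a p = [:- (4 * a), 0, 1:] * pderiv (pderiv p) + [:0, 3:] * pderiv p - smult ((of_nat n)\<^sup>2) p"

text \<open>Here \<open>k (k - 1) + 3 k = k (k + 2)\<close> produces the factor of the recurrence.
  The operator links only coefficients two places apart, so the two parities never mix.\<close>

lemma coeff_dickson_operator:
  "coeff (dickson_operator n a p) k =
     (of_nat (k * (k + 2)) - (of_nat n)\<^sup>2) * coeff p k - 4 * a * of_nat ((k + 2) * (k + 1)) * coeff p (k + 2)"
proof -
  show ?thesis
    \<comment> \<open>Multiplication by \<open>x\<close> and \<open>x^2\<close> shifts coefficients,
      so \<open>k = 0\<close>, \<open>k = 1\<close> and larger \<open>k\<close> are
      separated.\<close>
    by (cases k; cases "k - 1")
       (auto simp: dickson_operator_def coeff_pCons coeff_pderiv algebra_simps power2_eq_square)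
qed

lemma dickson_operator_dickson3:
  "dickson_operator n a (dickson3 n a) = smult (2 * of_nat n) (dickson1 n a)"
proof (cases "n = 0")
  case True
  then show ?thesis by (simp add: dickson3_def dickson_operator_def)
next
  case False
  then have n: "n > 0" by simp
  show ?thesis
  proof (rule poly_eqI)
    fix k
    let ?d = "coeff (dickson1 n a)" and ?f = "coeff (dickson3 n a)"
    have "of_nat n * coeff (dickson_operator n a (dickson3 n a)) k =
        (of_nat (k * (k + 2)) - (of_nat n)\<^sup>2) * (of_nat n * ?f k) -
          4 * a * of_nat ((k + 2) * (k + 1)) * (of_nat n * ?f (k + 2))"
      unfolding coeff_dickson_operator by (simp add: algebra_simps)
    also have "\<dots> = of_nat k * (of_nat (k * (k + 2)) - (of_nat n)\<^sup>2) * ?d k -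
          of_nat (k + 2) * (4 * a * of_nat ((k + 2) * (k + 1)) * ?d (k + 2))"
      unfolding coeff_dickson3[OF n] by (simp only: ac_simps)
    \<comment> \<open>\<open>k (k (k + 2) - n^2) - (k + 2) (k^2 - n^2) = 2 n^2\<close>.\<close>
    also have "\<dots> = of_nat n * (2 * of_nat n * ?d k)"
      unfolding coeff_dickson1_recurrence[OF n] by (simp add: algebra_simps power2_eq_square)
    finally show "coeff (dickson_operator n a (dickson3 n a)) k = coeff (smult (2 * of_nat n) (dickson1 n a)) k"
      using n by simp
  qed
qed

text \<open>\<open>u\<close> is a root of \<open>u^2 - x u + a\<close>, whose discriminant is
  \<open>x^2 - 4 a\<close>; the double root is the case \<open>u^2 = a\<close>. As the product of
  the roots is \<open>a \<noteq> 0\<close>, neither root is zero.\<close>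

lemma dickson_domain_eq:
  assumes "a \<noteq> 0"
  shows "dickson_domain a = {x. x\<^sup>2 \<noteq> 4 * a}"
proof (intro equalityI subsetI)
  fix x assume "x \<in> dickson_domain a"
  then obtain u where u: "x = u + a / u" "u \<noteq> 0" "u\<^sup>2 \<noteq> a" by (auto simp: dickson_domain_def)
  have "u\<^sup>2 * (x\<^sup>2 - 4 * a) = (u\<^sup>2 - a)\<^sup>2"
    using u(2) by (simp add: u(1) field_simps power2_eq_square)
  with u(3) show "x \<in> {x. x\<^sup>2 \<noteq> 4 * a}" by auto
next
  fix x assume "x \<in> {x. x\<^sup>2 \<noteq> 4 * a}"
  then have x: "x\<^sup>2 \<noteq> 4 * a" by simp
  define d where "d = csqrt (x\<^sup>2 - 4 * a)"
  define u where "u = (x + d) / 2"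
  have d: "d\<^sup>2 = x\<^sup>2 - 4 * a" by (simp add: d_def)
  have "4 * (u * (x - u)) = x\<^sup>2 - d\<^sup>2"
    unfolding u_def by (simp add: field_simps power2_eq_square)
  then have ux: "u * (x - u) = a" using d by simp
  with assms have u0: "u \<noteq> 0" by auto
  have "x = u + a / u" using ux u0 by (simp add: field_simps)
  moreover have "u\<^sup>2 \<noteq> a"
  proof
    assume "u\<^sup>2 = a"
    with ux have "u * (2 * u - x) = 0" by (simp add: algebra_simps power2_eq_square)
    with u0 have "d = 0" by (simp add: u_def)
    with d x show False by simp
  qed
  ultimately show "x \<in> dickson_domain a" using u0 by (auto simp: dickson_domain_def)
qed

lemma open_dickson_domain:
  assumes "a \<noteq> 0"
  shows "open (dickson_domain a)"
proof -
  have "{x. x\<^sup>2 \<noteq> 4 * a} = - {x. x\<^sup>2 = 4 * a}" by auto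
  also have "open \<dots>" by (intro open_Compl closed_Collect_eq continuous_intros)
  finally show ?thesis by (simp add: dickson_domain_eq[OF assms])
qed

lemma infinite_dickson_domain:
  assumes "a \<noteq> 0"
  shows "infinite (dickson_domain a)"
proof -
  have "0 \<in> dickson_domain a" using assms by (simp add: dickson_domain_eq)
  then show ?thesis
    using open_dickson_domain[OF assms] finite_imp_not_open by blast
qed

lemma deriv_poly: "deriv (poly p) = poly (pderiv p)" for p :: "complex poly"
  by (rule ext, rule DERIV_imp_deriv, rule poly_DERIV)

lemma solves_ode_poly_iff:
  "solves_ode_with_rhs n a g U (poly p) \<longleftrightarrow> (\<forall>x\<in>U. poly (dickson_operator n a p) x = g x)"
  unfolding solves_ode_with_rhs_def dickson_operator_def deriv_poly
  by (auto intro!: holomorphic_intros simp: algebra_simps power2_eq_square)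

text \<open>The domain is infinite, so equality of polynomial values on it is an identity of
  polynomials.\<close>

lemma solves_dickson_ode_poly_iff:
  assumes "a \<noteq> 0"
  shows "solves_dickson_ode n a (dickson_domain a) (poly p) \<longleftrightarrow>
    dickson_operator n a p = smult (2 * of_nat n) (dickson1 n a)" (is "?L \<longleftrightarrow> ?l = ?r")
proof
  assume ?L
  then have "dickson_domain a \<subseteq> {x. poly (?l - ?r) x = 0}"
    by (auto simp: solves_ode_poly_iff)
  with infinite_dickson_domain[OF assms] have "infinite {x. poly (?l - ?r) x = 0}"
    using finite_subset by blast
  then have "?l - ?r = 0" using poly_roots_finite by blast
  then show "?l = ?r" by simp
qed (simp add: solves_ode_poly_iff)

text \<open>The two cases of the recurrence are one formula: for the wrong parity the coefficient of
  the first-kind polynomial is zero, for the right one \<open>n - 2 * i = k\<close>. At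
  \<open>n = 0\<close> the factor \<open>2 n\<close> removes the term.\<close>

lemma dickson3_recurrence_iff:
  assumes "a \<noteq> 0"
  shows "dickson3_recurrence n a b \<longleftrightarrow> (\<forall>k\<le>n. 4 * a * of_nat ((k + 2) * (k + 1)) * b (k + 2) =
      (of_nat (k * (k + 2)) - (of_nat n)\<^sup>2) * b k - 2 * of_nat n * coeff (dickson1 n a) k)"
proof -
  have "(b (k + 2) = (if odd n \<and> even k \<or> even n \<and> odd k
      then - (((of_nat n)\<^sup>2 - of_nat (k * (k + 2))) / (4 * a * of_nat ((k + 2) * (k + 1)))) * b k
      else (let i = (n - k) div 2 in
        1 / (4 * a * of_nat ((k + 2) * (k + 1))) *
          ((of_nat (k * (k + 2)) - (of_nat n)\<^sup>2) * b k
            - 2 * of_nat n * coeff (dickson1 n a) (n - 2 * i))))) \<longleftrightarrow>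
      4 * a * of_nat ((k + 2) * (k + 1)) * b (k + 2) =
      (of_nat (k * (k + 2)) - (of_nat n)\<^sup>2) * b k - 2 * of_nat n * coeff (dickson1 n a) k"
    if "k \<le> n" for k
  proof -
    define A where "A = 4 * a * of_nat ((k + 2) * (k + 1))"
    have A: "A \<noteq> 0" unfolding A_def using assms by (simp only: mult_eq_0_iff of_nat_eq_0_iff) simp
    show ?thesis
    proof (cases "odd n \<and> even k \<or> even n \<and> odd k")
      case True
      then have "of_nat n * coeff (dickson1 n a) k = 0"
        by (cases "n = 0") (auto intro!: coeff_dickson1_eq_0)
      with True A show ?thesis
        unfolding A_def[symmetric] by (auto simp: field_simps)
    next
      case False
      then have "n - 2 * ((n - k) div 2) = k" using that by (auto simp: dvd_mult_div_cancel)
      with False A show ?thesis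
        unfolding A_def[symmetric] Let_def by (auto simp: field_simps)
    qed
  qed
  then show ?thesis unfolding dickson3_recurrence_def by blast
qed

text \<open>At a degree \<open>m > n\<close> the leading coefficient is multiplied by
  \<open>m (m + 2) - n^2 > 0\<close>, while the right-hand side contributes nothing there.\<close>

lemma dickson_operator_eq_imp_coeff_eq_0:
  assumes "dickson_operator n a p = smult (2 * of_nat n) (dickson1 n a)" and "k > n"
  shows "coeff p k = 0"
proof (rule ccontr)
  assume "coeff p k \<noteq> 0"
  then have "degree p \<ge> k" "p \<noteq> 0" by (auto intro: le_degree)
  then have m: "degree p > n" using assms(2) by simp
  have "of_nat n * coeff (dickson1 n a) (degree p) = 0"
    using m by (cases "n = 0") (auto intro!: coeff_dickson1_eq_0)
  moreover have "coeff p (degree p + 2) = 0" by (simp add: coeff_eq_0)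
  moreover have "coeff (dickson_operator n a p) (degree p) = 2 * of_nat n * coeff (dickson1 n a) (degree p)"
    unfolding assms(1) by simp
  ultimately have "(of_nat (degree p * (degree p + 2)) - (of_nat n)\<^sup>2) * coeff p (degree p) = 0"
    unfolding coeff_dickson_operator by simp
  then have "of_nat (degree p * (degree p + 2)) = (of_nat (n\<^sup>2) :: complex)"
    using \<open>p \<noteq> 0\<close> by simp
  then have "degree p * (degree p + 2) = n\<^sup>2" unfolding of_nat_eq_iff .
  moreover have "n * n < degree p * (degree p + 2)" using m by (intro mult_strict_mono) auto
  ultimately show False by (simp add: power2_eq_square)
qed

text \<open>For \<open>k \<le> n\<close> the recurrence is comparison of coefficients; for
  \<open>k > n\<close> both sides of the equation have coefficient zero once the degree is at most
  \<open>n\<close>.\<close>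

lemma dickson_operator_eq_iff_recurrence:
  assumes "a \<noteq> 0"
  shows "dickson_operator n a p = smult (2 * of_nat n) (dickson1 n a) \<longleftrightarrow>
    (\<exists>b. (\<forall>k>n. b k = 0) \<and> dickson3_recurrence n a b \<and> (\<forall>x. poly p x = (\<Sum>k=0..n. b k * x ^ k)))"
    (is "?L \<longleftrightarrow> ?R")
proof
  assume L: ?L
  then have z: "\<forall>k>n. coeff p k = 0" using dickson_operator_eq_imp_coeff_eq_0 by blast
  moreover have "dickson3_recurrence n a (coeff p)"
    unfolding dickson3_recurrence_iff[OF assms]
    using arg_cong[OF L, of "\<lambda>q. coeff q k" for k, unfolded coeff_dickson_operator coeff_smult]
    by (simp add: algebra_simps)
  moreover have "poly p x = (\<Sum>k=0..n. coeff p k * x ^ k)" for x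
  proof -
    have "degree p \<le> n" using z by (intro degree_le) auto
    then show ?thesis
      unfolding poly_altdef by (intro sum.mono_neutral_left) (auto simp: coeff_eq_0)
  qed
  ultimately show ?R by blast
next
  assume ?R
  then obtain b where b: "\<forall>k>n. b k = 0" "dickson3_recurrence n a b"
    and p: "\<And>x. poly p x = (\<Sum>k=0..n. b k * x ^ k)" by auto
  have "p = (\<Sum>k=0..n. monom (b k) k)"
    using p by (intro poly_ext) (auto simp: poly_sum poly_monom)
  then have c: "coeff p = b" using b(1) by (auto simp: fun_eq_iff coeff_sum not_le)
  show ?L
  proof (rule poly_eqI)
    fix k
    show "coeff (dickson_operator n a p) k = coeff (smult (2 * of_nat n) (dickson1 n a)) k"
    proof (cases "k \<le> n")
      case True
      then show ?thesis
        using b(2) unfolding coeff_dickson_operator c dickson3_recurrence_iff[OF assms] by simp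
    next
      case False
      have "of_nat n * coeff (dickson1 n a) k = 0"
        using False by (cases "n = 0") (auto intro!: coeff_dickson1_eq_0)
      then show ?thesis using b(1) False unfolding coeff_dickson_operator c by simp
    qed
  qed
qed

subsection \<open>Second-order equations and Wronskians\<close>

text \<open>Abel's identity: both Wronskians satisfy \<open>p w' = - q w\<close>, so their quotient
  has derivative zero. Taking the quotient avoids the explicit solution of this first-order
  equation, which would need a primitive of \<open>q / p\<close> on a possibly multiply connected
  set.\<close>

lemma wronskian_proportional:
  fixes U :: "complex set"
  assumes "open U" "connected U" and p: "\<And>x. x \<in> U \<Longrightarrow> p x \<noteq> 0"
    and f: "f holomorphic_on U" "\<And>x. x \<in> U \<Longrightarrow> p x * deriv (deriv f) x + q x * deriv f x + k * f x = 0"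
    and g: "g holomorphic_on U" "\<And>x. x \<in> U \<Longrightarrow> p x * deriv (deriv g) x + q x * deriv g x + k * g x = 0"
    and h: "h holomorphic_on U" "\<And>x. x \<in> U \<Longrightarrow> p x * deriv (deriv h) x + q x * deriv h x + k * h x = 0"
    and W: "\<And>x. x \<in> U \<Longrightarrow> g x * deriv h x - deriv g x * h x \<noteq> 0"
  shows "\<exists>A. \<forall>x\<in>U. f x * deriv h x - deriv f x * h x = A * (g x * deriv h x - deriv g x * h x)"
proof -
  define w where "w u v x = u x * deriv v x - deriv u x * v x" for u v :: "complex \<Rightarrow> complex" and x
  have w: "(w u v has_field_derivative u x * deriv (deriv v) x - deriv (deriv u) x * v x) (at x)"
    if "u holomorphic_on U" "v holomorphic_on U" "x \<in> U" for u v x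
    unfolding w_def using that \<open>open U\<close>
    by (auto intro!: derivative_eq_intros holomorphic_derivI[where S = U] holomorphic_deriv)
  have abel: "p x * (u x * deriv (deriv v) x - deriv (deriv u) x * v x) = - q x * w u v x"
    if "p x * deriv (deriv u) x + q x * deriv u x + k * u x = 0"
       "p x * deriv (deriv v) x + q x * deriv v x + k * v x = 0" for u v x
  proof -
    have "p x * (u x * deriv (deriv v) x - deriv (deriv u) x * v x) + q x * w u v x =
        u x * (p x * deriv (deriv v) x + q x * deriv v x + k * v x) -
        v x * (p x * deriv (deriv u) x + q x * deriv u x + k * u x)"
      unfolding w_def by (simp add: algebra_simps)
    then show ?thesis unfolding that by (simp add: eq_neg_iff_add_eq_0)
  qed
  have "((\<lambda>x. w f h x / w g h x) has_field_derivative 0) (at x)" if x: "x \<in> U" for x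
  proof -
    have nz: "w g h x \<noteq> 0" using W[OF x] by (simp add: w_def)
    let ?df = "f x * deriv (deriv h) x - deriv (deriv f) x * h x"
    let ?dg = "g x * deriv (deriv h) x - deriv (deriv g) x * h x"
    have "p x * (?df * w g h x - w f h x * ?dg) = 0"
    proof -
      have "p x * (?df * w g h x - w f h x * ?dg) = (p x * ?df) * w g h x - w f h x * (p x * ?dg)"
        by (simp add: algebra_simps)
      also have "\<dots> = 0"
        unfolding abel[OF f(2) h(2), OF x x] abel[OF g(2) h(2), OF x x] by simp
      finally show ?thesis .
    qed
    then have "?df * w g h x - w f h x * ?dg = 0" using p[OF x] by simp
    then show ?thesis
      using DERIV_divide[OF w[OF f(1) h(1) x] w[OF g(1) h(1) x] nz] by simp
  qed
  then have "(\<lambda>x. w f h x / w g h x) constant_on U"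
    by (rule has_field_derivative_0_imp_constant_on[OF _ \<open>connected U\<close> \<open>open U\<close>])
  then obtain A where A: "\<And>x. x \<in> U \<Longrightarrow> w f h x / w g h x = A"
    unfolding constant_on_def by blast
  have "w f h x = A * w g h x" if "x \<in> U" for x
    using A[OF that] W[OF that] by (simp add: w_def nonzero_divide_eq_eq)
  then show ?thesis unfolding w_def by blast
qed

text \<open>Cramer's rule in the form \<open>f W(g,h) = g W(f,h) - h W(f,g)\<close>, where the two
  Wronskians on the right are constant multiples of \<open>W(g,h)\<close>.\<close>

lemma second_order_ode_fundamental_pair:
  fixes U :: "complex set"
  assumes "open U" "connected U" and p: "\<And>x. x \<in> U \<Longrightarrow> p x \<noteq> 0"
    and f: "f holomorphic_on U" "\<And>x. x \<in> U \<Longrightarrow> p x * deriv (deriv f) x + q x * deriv f x + k * f x = 0"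
    and g: "g holomorphic_on U" "\<And>x. x \<in> U \<Longrightarrow> p x * deriv (deriv g) x + q x * deriv g x + k * g x = 0"
    and h: "h holomorphic_on U" "\<And>x. x \<in> U \<Longrightarrow> p x * deriv (deriv h) x + q x * deriv h x + k * h x = 0"
    and W: "\<And>x. x \<in> U \<Longrightarrow> g x * deriv h x - deriv g x * h x \<noteq> 0"
  shows "\<exists>A B. \<forall>x\<in>U. f x = A * g x + B * h x"
proof -
  have "\<exists>A. \<forall>x\<in>U. f x * deriv h x - deriv f x * h x = A * (g x * deriv h x - deriv g x * h x)"
    by (rule wronskian_proportional; fact)
  then obtain A where A: "\<And>x. x \<in> U \<Longrightarrow> f x * deriv h x - deriv f x * h x = A * (g x * deriv h x - deriv g x * h x)"
    by blast
  have W': "h x * deriv g x - deriv h x * g x \<noteq> 0" if "x \<in> U" for x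
    using W[OF that] by (simp add: algebra_simps)
  have "\<exists>B. \<forall>x\<in>U. f x * deriv g x - deriv f x * g x = B * (h x * deriv g x - deriv h x * g x)"
    by (rule wronskian_proportional; fact)
  then obtain B where B: "\<And>x. x \<in> U \<Longrightarrow> f x * deriv g x - deriv f x * g x = B * (h x * deriv g x - deriv h x * g x)"
    by blast
  have "f x = A * g x + B * h x" if x: "x \<in> U" for x
  proof -
    have "f x * (g x * deriv h x - deriv g x * h x) =
        g x * (f x * deriv h x - deriv f x * h x) - h x * (f x * deriv g x - deriv f x * g x)"
      by (simp add: algebra_simps)
    also have "\<dots> = (A * g x + B * h x) * (g x * deriv h x - deriv g x * h x)"
      unfolding A[OF x] B[OF x] by (simp add: algebra_simps)
    finally show ?thesis using W[OF x] by simp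
  qed
  then show ?thesis by blast
qed

subsection \<open>The Legendre equation and its branches\<close>

text \<open>The Legendre equation multiplied by \<open>z^2 - 1\<close>. Its left side is then
  holomorphic wherever \<open>f\<close> is, even at \<open>1\<close> and \<open>-1\<close>, so the
  identity theorem applies on any domain.\<close>

definition legendre_equation_on :: "complex \<Rightarrow> complex \<Rightarrow> complex set \<Rightarrow> (complex \<Rightarrow> complex) \<Rightarrow> bool" where
  "legendre_equation_on \<nu> \<mu> T f \<longleftrightarrow> f holomorphic_on T \<and> (\<forall>z\<in>T. (z\<^sup>2 - 1)\<^sup>2 * deriv (deriv f) z +
     2 * z * (z\<^sup>2 - 1) * deriv f z - (\<nu> * (\<nu> + 1) * (z\<^sup>2 - 1) + \<mu>\<^sup>2) * f z = 0)"

text \<open>By Abel's identity \<open>z^2 - 1\<close> times the Wronskian is constant. The value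
  \<open>K\<close> is kept as a parameter because continuation leaves it unchanged;
  \<open>K \<noteq> 0\<close> on the principal branch then gives independence on every
  branch.\<close>

definition legendre_pair_on ::
    "complex \<Rightarrow> complex \<Rightarrow> complex \<Rightarrow> complex set \<Rightarrow> (complex \<Rightarrow> complex) \<Rightarrow> (complex \<Rightarrow> complex) \<Rightarrow> bool" where
  "legendre_pair_on \<nu> \<mu> K T P Q \<longleftrightarrow> legendre_equation_on \<nu> \<mu> T P \<and> legendre_equation_on \<nu> \<mu> T Q \<and>
     (\<forall>z\<in>T. (z\<^sup>2 - 1) * (P z * deriv Q z - deriv P z * Q z) = K)"

lemma deriv_eq_on_open:
  assumes "open V" "\<And>z. z \<in> V \<Longrightarrow> f z = g z" "z \<in> V"
  shows "deriv f z = deriv g z"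
  using eventually_nhds_in_open[OF assms(1,3)] assms(2)
  by (intro deriv_cong_ev) (auto elim: eventually_mono)

lemma legendre_equation_on_cong:
  assumes f: "legendre_equation_on \<nu> \<mu> T f" and V: "open V" "V \<subseteq> T" and g: "\<And>z. z \<in> V \<Longrightarrow> g z = f z"
  shows "legendre_equation_on \<nu> \<mu> V g"
proof -
  have d: "deriv g z = deriv f z" if "z \<in> V" for z
    by (rule deriv_eq_on_open[OF V(1) g that])
  have d2: "deriv (deriv g) z = deriv (deriv f) z" if "z \<in> V" for z
    by (rule deriv_eq_on_open[OF V(1) d that])
  have "f holomorphic_on V"
    using f V(2) unfolding legendre_equation_on_def by (blast intro: holomorphic_on_subset)
  then have "g holomorphic_on V"
    by (rule holomorphic_transform) (simp add: g)
  then show ?thesis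
    using f V(2) unfolding legendre_equation_on_def by (auto simp: d d2 g)
qed

lemma legendre_equation_on_linear:
  assumes "legendre_equation_on \<nu> \<mu> T f" "legendre_equation_on \<nu> \<mu> T g" "open T"
  shows "legendre_equation_on \<nu> \<mu> T (\<lambda>z. A * f z + B * g z)"
proof -
  have f: "f holomorphic_on T" "deriv f holomorphic_on T" and g: "g holomorphic_on T" "deriv g holomorphic_on T"
    using assms by (auto simp: legendre_equation_on_def intro: holomorphic_deriv)
  have lin: "deriv (\<lambda>z. A * u z + B * v z) z = A * deriv u z + B * deriv v z"
    if "u holomorphic_on T" "v holomorphic_on T" "z \<in> T" for u v z
    using that by (intro DERIV_imp_deriv DERIV_add DERIV_cmult holomorphic_derivI[OF _ assms(3)])
  have d2: "deriv (deriv (\<lambda>z. A * f z + B * g z)) z = A * deriv (deriv f) z + B * deriv (deriv g) z" if "z \<in> T" for z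
    using deriv_eq_on_open[OF assms(3) lin[OF f(1) g(1)] that] lin[OF f(2) g(2) that] by simp
  have alg: "X * (A * u2 + B * v2) + Y * (A * u1 + B * v1) - Z * (A * u0 + B * v0) = 0"
    if "X * u2 + Y * u1 - Z * u0 = 0" "X * v2 + Y * v1 - Z * v0 = 0" for X Y Z u0 u1 u2 v0 v1 v2 :: complex
  proof -
    have "X * (A * u2 + B * v2) + Y * (A * u1 + B * v1) - Z * (A * u0 + B * v0) =
        A * (X * u2 + Y * u1 - Z * u0) + B * (X * v2 + Y * v1 - Z * v0)"
      by (simp add: algebra_simps)
    then show ?thesis unfolding that by simp
  qed
  show ?thesis
    unfolding legendre_equation_on_def
  proof (intro conjI ballI)
    show "(\<lambda>z. A * f z + B * g z) holomorphic_on T" by (intro holomorphic_intros f g)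
    fix z assume z: "z \<in> T"
    show "(z\<^sup>2 - 1)\<^sup>2 * deriv (deriv (\<lambda>z. A * f z + B * g z)) z + 2 * z * (z\<^sup>2 - 1) * deriv (\<lambda>z. A * f z + B * g z) z -
        (\<nu> * (\<nu> + 1) * (z\<^sup>2 - 1) + \<mu>\<^sup>2) * (A * f z + B * g z) = 0"
      unfolding d2[OF z] lin[OF f(1) g(1) z]
      by (rule alg) (use assms z in \<open>auto simp: legendre_equation_on_def\<close>)
  qed
qed

lemma legendre_pair_on_cong:
  assumes "legendre_pair_on \<nu> \<mu> K T P Q" and V: "open V" "V \<subseteq> T"
    and P: "\<And>z. z \<in> V \<Longrightarrow> P' z = P z" and Q: "\<And>z. z \<in> V \<Longrightarrow> Q' z = Q z"
  shows "legendre_pair_on \<nu> \<mu> K V P' Q'"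
proof -
  have "deriv P' z = deriv P z" "deriv Q' z = deriv Q z" if "z \<in> V" for z
    using deriv_eq_on_open[OF V(1) P that] deriv_eq_on_open[OF V(1) Q that] by auto
  then show ?thesis
    using assms(1) V(2) unfolding legendre_pair_on_def
    by (auto simp: P Q intro: legendre_equation_on_cong[OF _ V P] legendre_equation_on_cong[OF _ V Q])
qed

text \<open>The identity theorem, applied to the left sides of the two equations and of the
  Wronskian relation, all of which are holomorphic on \<open>T\<close>.\<close>

lemma legendre_pair_on_continuation:
  assumes V: "legendre_pair_on \<nu> \<mu> K V P Q" "open V" "V \<noteq> {}" "V \<subseteq> T"
    and T: "open T" "connected T" and hol: "P holomorphic_on T" "Q holomorphic_on T"
  shows "legendre_pair_on \<nu> \<mu> K T P Q"
proof -
  note [holomorphic_intros] = holomorphic_deriv[OF _ T(1)]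
  have ode: "(z\<^sup>2 - 1)\<^sup>2 * deriv (deriv f) z + 2 * z * (z\<^sup>2 - 1) * deriv f z -
      (\<nu> * (\<nu> + 1) * (z\<^sup>2 - 1) + \<mu>\<^sup>2) * f z = 0"
    if f: "f holomorphic_on T" "legendre_equation_on \<nu> \<mu> V f" and z: "z \<in> T" for f z
    by (rule analytic_continuation_open[where g = "\<lambda>_. 0", OF V(2) T(1) V(3) T(2) V(4) _ _ _ z])
       (use f in \<open>auto intro!: holomorphic_intros simp: legendre_equation_on_def\<close>)
  have "(z\<^sup>2 - 1) * (P z * deriv Q z - deriv P z * Q z) = K" if z: "z \<in> T" for z
    by (rule analytic_continuation_open[where g = "\<lambda>_. K", OF V(2) T(1) V(3) T(2) V(4) _ _ _ z])
       (use V(1) hol in \<open>auto intro!: holomorphic_intros simp: legendre_pair_on_def\<close>)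
  with ode V(1) hol show ?thesis
    unfolding legendre_pair_on_def by (simp add: legendre_equation_on_def)
qed

text \<open>Each link of the chain restricts the pair from \<open>S\<close> to \<open>V\<close> and
  extends it from \<open>V\<close> to \<open>T\<close>. The constant \<open>K\<close> involves both
  functions, so it survives only because they are continued through the same
  \<open>V\<close>.\<close>

lemma legendre_branch_pair:
  assumes "legendre_branch \<nu> \<mu> P Q T"
    and "legendre_pair_on \<nu> \<mu> K legendre_cut_plane (legendreP \<nu> \<mu>) (legendreQ \<nu> \<mu>)"
  shows "legendre_pair_on \<nu> \<mu> K T P Q"
  using assms(1)
proof (induction rule: legendre_branch.induct)
  case principal
  show ?case by (rule assms(2))
next
  case (continue P Q S T P' Q' V)
  have V: "V \<subseteq> S" "V \<subseteq> T" using continue.hyps by blast+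
  have "legendre_pair_on \<nu> \<mu> K V P' Q'"
    by (rule legendre_pair_on_cong[OF continue.IH _ V(1)]) (use continue.hyps in blast)+
  then show ?case
    by (rule legendre_pair_on_continuation[OF _ _ _ V(2)]) (use continue.hyps in blast)+
qed

lemma open_legendre_cut_plane: "open legendre_cut_plane"
  unfolding legendre_cut_plane_def
  by (simp add: open_Compl closed_slot_left)

lemma legendre_branch_open:
  assumes "legendre_branch \<nu> \<mu> P Q T"
  shows "open T"
  using assms by cases (auto simp: open_legendre_cut_plane)

section \<open>The change of variables between the two equations\<close>

text \<open>Differentiating \<open>r^4 = x^2 - 4 a\<close> gives
  \<open>r' / r = x / (2 (x^2 - 4 a))\<close>, whichever branch of the fourth root \<open>r\<close>
  is.\<close>

lemma DERIV_fourth_root: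
  fixes r :: "complex \<Rightarrow> complex"
  assumes "open U" "r holomorphic_on U" "\<And>x. x \<in> U \<Longrightarrow> r x ^ 4 = x\<^sup>2 - 4 * a" "x \<in> U" "x\<^sup>2 \<noteq> 4 * a"
  shows "((\<lambda>x. 1 / r x) has_field_derivative - (x / (2 * (x\<^sup>2 - 4 * a))) * (1 / r x)) (at x)"
proof -
  have r0: "r x \<noteq> 0" using assms(3)[OF assms(4)] assms(5) by auto
  have dr: "(r has_field_derivative deriv r x) (at x)"
    using assms by (auto intro: holomorphic_derivI)
  have "((\<lambda>x. r x ^ 4) has_field_derivative 4 * r x ^ 3 * deriv r x) (at x)"
    by (auto intro!: derivative_eq_intros dr)
  moreover have "((\<lambda>x. r x ^ 4) has_field_derivative 2 * x) (at x)"
  proof (rule has_field_derivative_transform_within_open[where S = U])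
    show "((\<lambda>x. x\<^sup>2 - 4 * a) has_field_derivative 2 * x) (at x)"
      by (auto intro!: derivative_eq_intros)
  qed (use assms in auto)
  ultimately have "4 * r x ^ 3 * deriv r x = 2 * x" by (rule DERIV_unique)
  then have e: "2 * r x ^ 4 * deriv r x = x * r x"
    by (simp add: power4_eq_xxxx power3_eq_cube algebra_simps)
  have "((\<lambda>x. 1 / r x) has_field_derivative - (deriv r x / (r x * r x))) (at x)"
    using r0 by (auto intro!: derivative_eq_intros dr simp: divide_simps)
  moreover have "- (deriv r x / (r x * r x)) = - (x / (2 * (x\<^sup>2 - 4 * a))) * (1 / r x)"
    using e assms(5) r0 unfolding assms(3)[OF assms(4)] by (simp add: divide_simps mult.commute)
  ultimately show ?thesis by simp
qed

lemma DERIV_legendre_substitution: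
  fixes r g :: "complex \<Rightarrow> complex"
  assumes "open U" "open T" and s: "s \<noteq> 0" "(\<lambda>x. x / (2 * s)) ` U \<subseteq> T" and g: "g holomorphic_on T"
    and r: "r holomorphic_on U" "\<And>x. x \<in> U \<Longrightarrow> r x ^ 4 = x\<^sup>2 - 4 * a" and "x \<in> U" "x\<^sup>2 \<noteq> 4 * a"
  shows "((\<lambda>x. 1 / r x * g (x / (2 * s))) has_field_derivative
     1 / r x * (deriv g (x / (2 * s)) / (2 * s) - x / (2 * (x\<^sup>2 - 4 * a)) * g (x / (2 * s)))) (at x)"
proof -
  have "(g has_field_derivative deriv g (x / (2 * s))) (at (x / (2 * s)))"
    using assms by (intro holomorphic_derivI[where S = T]) auto
  moreover have "((\<lambda>x. x / (2 * s)) has_field_derivative 1 / (2 * s)) (at x)"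
    using s by (auto intro!: derivative_eq_intros)
  ultimately have 2: "((\<lambda>x. g (x / (2 * s))) has_field_derivative deriv g (x / (2 * s)) * (1 / (2 * s))) (at x)"
    by (rule DERIV_chain2)
  have 1: "((\<lambda>x. 1 / r x) has_field_derivative - (x / (2 * (x\<^sup>2 - 4 * a))) * (1 / r x)) (at x)"
    by (rule DERIV_fourth_root; fact)
  have alg: "- c * R * g0 + g1 * (1 / t) * R = R * (g1 / t - c * g0)" for c R g0 g1 t :: complex
    by (simp add: algebra_simps)
  show ?thesis by (rule DERIV_cong[OF DERIV_mult[OF 1 2]]) (rule alg)
qed

text \<open>The factor \<open>1 / r\<close> lowers the first-order coefficient from
  \<open>3 z\<close> to the \<open>2 z\<close> of Legendre's equation. The price is the zeroth-order
  term \<open>1/2 + z^2 / (4 (z^2 - 1)) = 3/4 + 1 / (4 (z^2 - 1))\<close>, which fixes both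
  \<open>\<nu> (\<nu> + 1)\<close> and \<open>\<mu>^2\<close>.\<close>

lemma solves_homogeneous_ode_substitution:
  fixes r g :: "complex \<Rightarrow> complex"
  assumes "open U" "open T" and s: "s \<noteq> 0" "s\<^sup>2 = a" "(\<lambda>x. x / (2 * s)) ` U \<subseteq> T"
    and r: "r holomorphic_on U" "\<And>x. x \<in> U \<Longrightarrow> r x ^ 4 = x\<^sup>2 - 4 * a"
    and U: "\<And>x. x \<in> U \<Longrightarrow> x\<^sup>2 \<noteq> 4 * a"
    and g: "legendre_equation_on \<nu> (1 / 2) T g" and \<nu>: "\<nu> * (\<nu> + 1) = (of_nat n)\<^sup>2 + 3 / 4"
  shows "solves_homogeneous_ode n a U (\<lambda>x. 1 / r x * g (x / (2 * s)))"
  unfolding solves_ode_with_rhs_def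
proof (intro conjI ballI)
  let ?F = "\<lambda>x. 1 / r x * g (x / (2 * s))"
  have hol: "g holomorphic_on T" "deriv g holomorphic_on T"
    using g \<open>open T\<close> by (auto simp: legendre_equation_on_def intro: holomorphic_deriv)
  have D: "((\<lambda>x. 1 / r x * h (x / (2 * s))) has_field_derivative
      1 / r x * (deriv h (x / (2 * s)) / (2 * s) - x / (2 * (x\<^sup>2 - 4 * a)) * h (x / (2 * s)))) (at x)"
    if "h holomorphic_on T" "x \<in> U" for h x
    by (rule DERIV_legendre_substitution[OF assms(1,2) s(1,3) that(1) r(1) r(2) that(2) U[OF that(2)]])
  show "?F holomorphic_on U"
    using D[OF hol(1)] \<open>open U\<close> by (auto simp: holomorphic_on_open)
  fix x assume x: "x \<in> U"
  have d1: "deriv ?F y = 1 / r y * deriv g (y / (2 * s)) / (2 * s) - y / (2 * (y\<^sup>2 - 4 * a)) * ?F y" if "y \<in> U" for y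
  proof -
    have "R * (g1 / t - c * g0) = R * g1 / t - c * (R * g0)" for R g1 t c g0 :: complex
      by (simp add: algebra_simps)
    with DERIV_imp_deriv[OF D[OF hol(1) that]] show ?thesis by (rule trans)
  qed
  define z where "z = x / (2 * s)"
  have xz: "x = 2 * s * z" using s(1) by (simp add: z_def)
  have z2: "x\<^sup>2 - 4 * a = 4 * a * (z\<^sup>2 - 1)"
    unfolding xz s(2)[symmetric] by (simp add: algebra_simps power2_eq_square)
  have a0: "a \<noteq> 0" using s by auto
  have z0: "z\<^sup>2 - 1 \<noteq> 0" using U[OF x] z2 by auto
  have "deriv (deriv ?F) x = deriv (\<lambda>y. (1 / r y * deriv g (y / (2 * s))) / (2 * s) - y / (2 * (y\<^sup>2 - 4 * a)) * ?F y) x"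
    by (rule deriv_eq_on_open[OF \<open>open U\<close> d1 x])
  also have "\<dots> = 1 / r x * (deriv (deriv g) z / (2 * s) - x / (2 * (x\<^sup>2 - 4 * a)) * deriv g z) / (2 * s) -
      ((2 * (x\<^sup>2 - 4 * a) - x * (4 * x)) / (2 * (x\<^sup>2 - 4 * a))\<^sup>2 * ?F x +
        x / (2 * (x\<^sup>2 - 4 * a)) * (1 / r x * (deriv g z / (2 * s) - x / (2 * (x\<^sup>2 - 4 * a)) * g z)))"
    unfolding z_def
  proof (rule DERIV_imp_deriv)
    show "((\<lambda>y. (1 / r y * deriv g (y / (2 * s))) / (2 * s) - y / (2 * (y\<^sup>2 - 4 * a)) * ?F y) has_field_derivative
      1 / r x * (deriv (deriv g) (x / (2 * s)) / (2 * s) - x / (2 * (x\<^sup>2 - 4 * a)) * deriv g (x / (2 * s))) / (2 * s) -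
      ((2 * (x\<^sup>2 - 4 * a) - x * (4 * x)) / (2 * (x\<^sup>2 - 4 * a))\<^sup>2 * ?F x +
        x / (2 * (x\<^sup>2 - 4 * a)) * (1 / r x * (deriv g (x / (2 * s)) / (2 * s) - x / (2 * (x\<^sup>2 - 4 * a)) * g (x / (2 * s)))))) (at x)"
    proof -
      have e: "((\<lambda>y. y / (2 * (y\<^sup>2 - 4 * a))) has_field_derivative
          (2 * (x\<^sup>2 - 4 * a) - x * (4 * x)) / (2 * (x\<^sup>2 - 4 * a))\<^sup>2) (at x)"
        using U[OF x] by (auto intro!: derivative_eq_intros simp: power2_eq_square)
      have alg: "A - (B + C * D) = A - (B + D * C)" for A B C D :: complex by simp
      show ?thesis
        by (rule DERIV_cong[OF DERIV_diff[OF DERIV_cdivide[OF D[OF hol(2) x]] DERIV_mult[OF e D[OF hol(1) x]]]])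
           (rule alg)
    qed
  qed
  finally have ddF: "deriv (deriv ?F) x = 1 / r x * (deriv (deriv g) z / (2 * s) - x / (2 * (x\<^sup>2 - 4 * a)) * deriv g z) / (2 * s) -
      ((2 * (x\<^sup>2 - 4 * a) - x * (4 * x)) / (2 * (x\<^sup>2 - 4 * a))\<^sup>2 * (1 / r x * g z) +
        x / (2 * (x\<^sup>2 - 4 * a)) * (1 / r x * (deriv g z / (2 * s) - x / (2 * (x\<^sup>2 - 4 * a)) * g z)))"
    unfolding z_def .
  have dd: "deriv (deriv ?F) x = 1 / r x * ((deriv (deriv g) z / (2 * s) - x / (2 * (x\<^sup>2 - 4 * a)) * deriv g z) / (2 * s) -
      (2 * (x\<^sup>2 - 4 * a) - x * (4 * x)) / (2 * (x\<^sup>2 - 4 * a))\<^sup>2 * g z -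
        x / (2 * (x\<^sup>2 - 4 * a)) * (deriv g z / (2 * s) - x / (2 * (x\<^sup>2 - 4 * a)) * g z))"
  proof -
    have "R * G / t - (e * (R * g0) + c * (R * H)) = R * (G / t - e * g0 - c * H)" for R G t e g0 c H :: complex
      by (simp add: algebra_simps)
    with ddF show ?thesis by (rule trans)
  qed
  have dx: "deriv ?F x = 1 / r x * (deriv g z / (2 * s) - x / (2 * (x\<^sup>2 - 4 * a)) * g z)"
    using DERIV_imp_deriv[OF D[OF hol(1) x]] unfolding z_def .
  \<comment> \<open>With values and derivatives of \<open>g\<close> replaced by free variables, what
    remains is an identity of rational functions.\<close>
  have alg: "X * ((g2 / (2 * s) - 2 * s * z / (2 * X) * g1) / (2 * s) -
      (2 * X - 2 * s * z * (4 * (2 * s * z))) / (2 * X)\<^sup>2 * g0 -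
        2 * s * z / (2 * X) * (g1 / (2 * s) - 2 * s * z / (2 * X) * g0)) +
      3 * (2 * s * z) * (g1 / (2 * s) - 2 * s * z / (2 * X) * g0) - N * g0 =
      ((z\<^sup>2 - 1)\<^sup>2 * g2 + 2 * z * (z\<^sup>2 - 1) * g1 - ((N + 3 / 4) * (z\<^sup>2 - 1) + 1 / 4) * g0) / (z\<^sup>2 - 1)"
    if X: "X = 4 * s\<^sup>2 * (z\<^sup>2 - 1)" for X g0 g1 g2 N :: complex
  proof -
    have X0: "X \<noteq> 0" using X s(1) z0 by simp
    have divw: "w * g2 + 2 * z * g1 - (1 / 2 + N + (1 / 4 + 1 / (4 * w))) * g0 =
        (w\<^sup>2 * g2 + 2 * z * w * g1 - ((N + 3 / 4) * w + 1 / 4) * g0) / w" if "w \<noteq> 0" for w :: complex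
      using that by (simp add: field_simps power2_eq_square)
    have "X * ((g2 / (2 * s) - 2 * s * z / (2 * X) * g1) / (2 * s) -
        (2 * X - 2 * s * z * (4 * (2 * s * z))) / (2 * X)\<^sup>2 * g0 -
        2 * s * z / (2 * X) * (g1 / (2 * s) - 2 * s * z / (2 * X) * g0)) +
        3 * (2 * s * z) * (g1 / (2 * s) - 2 * s * z / (2 * X) * g0) - N * g0 =
        X / (4 * s\<^sup>2) * g2 + 2 * z * g1 - (1 / 2 + N + s\<^sup>2 * z\<^sup>2 / X) * g0"
      using X0 s(1) by (simp add: field_simps power2_eq_square)
    also have "X / (4 * s\<^sup>2) = z\<^sup>2 - 1" using s(1) by (simp add: X)
    also have "s\<^sup>2 * z\<^sup>2 / X = 1 / 4 + 1 / (4 * (z\<^sup>2 - 1))"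
      using s(1) z0 by (simp add: X field_simps)
    also have "(z\<^sup>2 - 1) * g2 + 2 * z * g1 - (1 / 2 + N + (1 / 4 + 1 / (4 * (z\<^sup>2 - 1)))) * g0 =
        ((z\<^sup>2 - 1)\<^sup>2 * g2 + 2 * z * (z\<^sup>2 - 1) * g1 - ((N + 3 / 4) * (z\<^sup>2 - 1) + 1 / 4) * g0) / (z\<^sup>2 - 1)"
      by (rule divw[OF z0])
    finally show ?thesis .
  qed
  have "(x\<^sup>2 - 4 * a) * deriv (deriv ?F) x + 3 * x * deriv ?F x - (of_nat n)\<^sup>2 * ?F x =
     1 / r x * ((x\<^sup>2 - 4 * a) * ((deriv (deriv g) z / (2 * s) - x / (2 * (x\<^sup>2 - 4 * a)) * deriv g z) / (2 * s) -
      (2 * (x\<^sup>2 - 4 * a) - x * (4 * x)) / (2 * (x\<^sup>2 - 4 * a))\<^sup>2 * g z -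
        x / (2 * (x\<^sup>2 - 4 * a)) * (deriv g z / (2 * s) - x / (2 * (x\<^sup>2 - 4 * a)) * g z)) +
        3 * x * (deriv g z / (2 * s) - x / (2 * (x\<^sup>2 - 4 * a)) * g z) - (of_nat n)\<^sup>2 * g z)"
  proof -
    have "X * (R * G) + 3 * y * (R * H) - N * (R * g0) = R * (X * G + 3 * y * H - N * g0)" for X R G y H N g0 :: complex
      by (simp add: algebra_simps)
    then show ?thesis unfolding dd dx z_def[symmetric] .
  qed
  also have "\<dots> = 1 / r x * (((z\<^sup>2 - 1)\<^sup>2 * deriv (deriv g) z + 2 * z * (z\<^sup>2 - 1) * deriv g z -
      (\<nu> * (\<nu> + 1) * (z\<^sup>2 - 1) + (1 / 2)\<^sup>2) * g z) / (z\<^sup>2 - 1))"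
  proof -
    have "x\<^sup>2 - 4 * a = 4 * s\<^sup>2 * (z\<^sup>2 - 1)" using z2 s(2) by simp
    from alg[OF this, folded xz] show ?thesis by (simp add: \<nu> power2_eq_square[of "1 / 2"])
  qed
  also have "\<dots> = 0"
  proof -
    have "z \<in> T" using s(3) x by (auto simp: z_def)
    then have "(z\<^sup>2 - 1)\<^sup>2 * deriv (deriv g) z + 2 * z * (z\<^sup>2 - 1) * deriv g z -
        (\<nu> * (\<nu> + 1) * (z\<^sup>2 - 1) + (1 / 2)\<^sup>2) * g z = 0"
      using g unfolding legendre_equation_on_def by blast
    then show ?thesis by (simp only: div_0 mult_zero_right)
  qed
  finally show "(x\<^sup>2 - 4 * a) * deriv (deriv ?F) x + 3 * x * deriv ?F x - (of_nat n)\<^sup>2 * ?F x = 0" .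
qed

subsection \<open>Closed forms of hypergeometric functions\<close>

text \<open>Comparing coefficients gives
  \<open>(c + m) (m + 1) F (m + 1) = (a + m) (b + m) F m\<close>; as \<open>c + m\<close> never
  vanishes, the power series solution is determined by its value at \<open>0\<close>.\<close>

lemma has_fps_expansion_hypergeometric_ode:
  fixes f :: "complex \<Rightarrow> complex"
  assumes S: "open S" "0 \<in> S" "f holomorphic_on S"
    and ode: "\<And>w. w \<in> S \<Longrightarrow> w * (1 - w) * deriv (deriv f) w + (c - (a + b + 1) * w) * deriv f w - a * b * f w = 0"
    and f0: "f 0 = 1" and c: "\<And>m. c + of_nat m \<noteq> 0"
  shows "f has_fps_expansion fps_hypergeo [a, b] [c] 1"
proof -
  define F where "F = fps_expansion f 0"
  have F: "f has_fps_expansion F" unfolding F_def by (rule has_fps_expansion_fps_expansion[OF S])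
  have "(\<lambda>w. w * (1 - w) * deriv (deriv f) w + (c - (a + b + 1) * w) * deriv f w - a * b * f w) has_fps_expansion
      fps_X * (1 - fps_X) * fps_deriv (fps_deriv F) +
      (fps_const c - fps_const (a + b + 1) * fps_X) * fps_deriv F - fps_const (a * b) * F"
    by (intro fps_expansion_intros F)
  moreover have "(\<lambda>w. w * (1 - w) * deriv (deriv f) w + (c - (a + b + 1) * w) * deriv f w - a * b * f w)
      has_fps_expansion 0"
    unfolding has_fps_expansion_0_iff using eventually_nhds_in_open[OF S(1,2)] by eventually_elim (rule ode)
  ultimately have 0: "fps_X * (1 - fps_X) * fps_deriv (fps_deriv F) +
      (fps_const c - fps_const (a + b + 1) * fps_X) * fps_deriv F - fps_const (a * b) * F = 0"
    by (rule fps_expansion_unique_complex)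
  have rec: "(c + of_nat m) * of_nat (Suc m) * fps_nth F (Suc m) = (a + of_nat m) * (b + of_nat m) * fps_nth F m" for m
  proof -
    have "fps_nth (fps_X * (1 - fps_X) * fps_deriv (fps_deriv F) +
      (fps_const c - fps_const (a + b + 1) * fps_X) * fps_deriv F - fps_const (a * b) * F) m = 0"
      unfolding 0 by simp
    moreover have "fps_X * (1 - fps_X) * fps_deriv (fps_deriv F) +
      (fps_const c - fps_const (a + b + 1) * fps_X) * fps_deriv F - fps_const (a * b) * F =
      fps_X * fps_deriv (fps_deriv F) - fps_X * (fps_X * fps_deriv (fps_deriv F)) +
      fps_const c * fps_deriv F - fps_const (a + b + 1) * (fps_X * fps_deriv F) - fps_const (a * b) * F"
      by (simp add: algebra_simps)
    ultimately show ?thesis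
      by (cases m; cases "m - 1") (auto simp: algebra_simps)
  qed
  have "fps_nth F m = fps_nth (fps_hypergeo [a, b] [c] 1) m" for m
  proof (induction m)
    case 0
    show ?case using f0 has_fps_expansion_imp_0_eq_fps_nth_0[OF F] by simp
  next
    case (Suc m)
    have "fps_nth F (Suc m) = (a + of_nat m) * (b + of_nat m) / ((c + of_nat m) * of_nat (Suc m)) * fps_nth F m"
      using rec[of m] c[of m] by (simp add: divide_simps del: of_nat_Suc) (simp add: mult.commute)
    then show ?case unfolding fps_hypergeo_rec Suc by (simp add: mult.commute)
  qed
  then have "F = fps_hypergeo [a, b] [c] 1" by (rule fps_ext)
  with F show ?thesis by simp
qed

text \<open>The candidate \<open>f\<close> itself proves that the choice in \<open>hyp2F1\<close> is
  not vacuous, and the identity theorem makes the chosen function equal to it. The derivatives are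
  asked for on an open part \<open>V\<close> only, because explicit formulas may be singular
  elsewhere in the slit plane.\<close>

lemma hyp2F1_eqI:
  fixes f :: "complex \<Rightarrow> complex"
  assumes hol: "f holomorphic_on - (of_real ` {1..})"
    and V: "open V" "V \<noteq> {}" "V \<subseteq> - (of_real ` {1..})"
    and f': "\<And>w. w \<in> V \<Longrightarrow> (f has_field_derivative f' w) (at w)"
    and f'': "\<And>w. w \<in> V \<Longrightarrow> (f' has_field_derivative f'' w) (at w)"
    and ode: "\<And>w. w \<in> V \<Longrightarrow> w * (1 - w) * f'' w + (c - (a + b + 1) * w) * f' w - a * b * f w = 0"
    and f0: "f 0 = 1" and c: "\<And>m. c + of_nat m \<noteq> 0" and w: "w \<notin> of_real ` {1..}"
  shows "hyp2F1 a b c w = f w"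
proof -
  define C where "C = - (complex_of_real ` {1..})"
  have C: "open C" "connected C" "ball 0 1 \<subseteq> C" "0 \<in> C"
    unfolding C_def
    by (auto intro!: starlike_imp_connected starlike_slotted_complex_plane_right open_Compl closed_slot_right)
  let ?P = "\<lambda>g. g holomorphic_on C \<and> (\<forall>w\<in>ball 0 1. g w = eval_fps (fps_hypergeo [a, b] [c] 1) w)"
  have fC: "f holomorphic_on C" using hol by (simp add: C_def)
  have d: "deriv f w = f' w" if "w \<in> V" for w
    using DERIV_imp_deriv[OF f'] that by simp
  have dd: "deriv (deriv f) w = f'' w" if "w \<in> V" for w
    using DERIV_imp_deriv[OF f''[OF that]]
    by (subst deriv_cong_ev[where g = f'])
       (use eventually_nhds_in_open[OF V(1) that] in \<open>auto elim: eventually_mono simp: d\<close>)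
  note [holomorphic_intros] = holomorphic_deriv[OF _ C(1)]
  have "w * (1 - w) * deriv (deriv f) w + (c - (a + b + 1) * w) * deriv f w - a * b * f w = 0" if w: "w \<in> C" for w
    by (rule analytic_continuation_open[where g = "\<lambda>_. 0", OF V(1) C(1) V(2) C(2) V(3)[folded C_def] _ _ _ w])
       (auto simp: d dd ode intro!: holomorphic_intros fC)
  then have F: "f has_fps_expansion fps_hypergeo [a, b] [c] 1"
    by (intro has_fps_expansion_hypergeometric_ode[OF C(1,4) fC _ f0 c])
  from fC have fb: "f holomorphic_on ball 0 1" using C(3) by (rule holomorphic_on_subset)
  \<comment> \<open>As \<open>f\<close> is holomorphic on the unit disc, its expansion at
    \<open>0\<close> represents it on the whole disc.\<close>
  have Pf: "?P f"
    using fC has_fps_expansion_imp_eval_fps_eq[OF F _ fb] by (auto simp: dist_norm)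
  then have P: "?P (hyp2F1 a b c)"
    unfolding hyp2F1_def C_def by (rule someI[where P = ?P, unfolded C_def])
  show ?thesis
    by (rule analytic_continuation_open[of "ball 0 1" C])
       (use C P Pf fC w in \<open>auto simp: C_def\<close>)
qed

lemma Re_csqrt_pos: "z \<notin> \<real>\<^sub>\<le>\<^sub>0 \<Longrightarrow> Re (csqrt z) > 0"
proof (rule ccontr)
  assume z: "z \<notin> \<real>\<^sub>\<le>\<^sub>0" and "\<not> Re (csqrt z) > 0"
  then have "Re (csqrt z) = 0" using Re_csqrt[of z] by linarith
  then have "Re ((csqrt z)\<^sup>2) \<le> 0" "Im ((csqrt z)\<^sup>2) = 0" by (simp_all add: power2_eq_square)
  with z show False by (simp add: complex_nonpos_Reals_iff)
qed

text \<open>Think of \<open>q = cosh t\<close> and \<open>p = sinh t\<close>, so that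
  \<open>q + p\<close> and \<open>q - p\<close> are \<open>exp t\<close> and
  \<open>exp (- t)\<close>. The real parts of a number and its inverse have the same sign, and here
  they add up to \<open>2 Re q > 0\<close>; so both lie in the right half plane and the principal
  logarithm is exact.\<close>

lemma sqrt_sum_inverse:
  fixes p q :: complex
  assumes "q\<^sup>2 - p\<^sup>2 = 1" "Re q > 0"
  shows "q - p = inverse (q + p)" "Re (q + p) > 0" "Ln (q - p) = - Ln (q + p)"
proof -
  have "(q - p) * (q + p) = 1" using assms(1) by (simp add: algebra_simps power2_eq_square)
  then show eq: "q - p = inverse (q + p)"
    by (simp add: inverse_unique mult.commute)
  have "Re (q + p) + Re (inverse (q + p)) = 2 * Re q"
    unfolding eq[symmetric] by simp
  moreover have "Re (inverse (q + p)) = Re (q + p) / (cmod (q + p))\<^sup>2"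
    by (simp add: cmod_power2)
  ultimately have "Re (q + p) * (1 + 1 / (cmod (q + p))\<^sup>2) = 2 * Re q"
    by (simp only: distrib_left mult_1_right times_divide_eq_right)
  then have "Re (q + p) * (1 + 1 / (cmod (q + p))\<^sup>2) > 0"
    using assms(2) by simp
  then show pos: "Re (q + p) > 0"
    by (rule zero_less_mult_pos2) (simp add: add_pos_nonneg)
  then have "q + p \<notin> \<real>\<^sub>\<le>\<^sub>0" by (simp add: complex_nonpos_Reals_iff)
  then show "Ln (q - p) = - Ln (q + p)" unfolding eq by (rule Ln_inverse)
qed

text \<open>
  With \<open>w = - sinh\<^sup>2 (\<theta>/2)\<close> this is \<open>exp (c \<theta>) / cosh (\<theta>/2)\<close>; the half sum over \<open>\<plusminus>c\<close> will be the function \<open>hyp2F1\<close>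
  in \<open>legendreP\<close>.
\<close>

definition hyp_exp :: "complex \<Rightarrow> complex \<Rightarrow> complex" where
  "hyp_exp c w = exp (2 * c * Ln (csqrt (- w) + csqrt (1 - w))) / csqrt (1 - w)"

text \<open>With \<open>p = csqrt (- w)\<close> and \<open>q = csqrt (1 - w)\<close> one has
  \<open>p' = - 1 / (2 p)\<close>, \<open>q' = - 1 / (2 q)\<close> and
  \<open>Ln (p + q)' = - 1 / (2 p q)\<close>. The last claim is the hypergeometric equation with
  parameters \<open>1/2 - c\<close>, \<open>1/2 + c\<close>, \<open>1/2\<close>.\<close>

lemma hyp_exp_derivs:
  fixes c :: complex
  defines "E \<equiv> \<lambda>w. exp (2 * c * Ln (csqrt (- w) + csqrt (1 - w)))"
  assumes "w \<notin> of_real ` {0..}"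
  shows "(hyp_exp c has_field_derivative
      E w * (1 / (2 * csqrt (1 - w) ^ 3) - c / (csqrt (- w) * (csqrt (1 - w))\<^sup>2))) (at w)" (is ?D1)
    and "((\<lambda>w. E w * (1 / (2 * csqrt (1 - w) ^ 3) - c / (csqrt (- w) * (csqrt (1 - w))\<^sup>2))) has_field_derivative
      E w * (c\<^sup>2 / ((csqrt (- w))\<^sup>2 * csqrt (1 - w) ^ 3) -
        c * (1 / (2 * csqrt (- w) ^ 3 * (csqrt (1 - w))\<^sup>2) + 3 / (2 * csqrt (- w) * csqrt (1 - w) ^ 4)) +
        3 / (4 * csqrt (1 - w) ^ 5))) (at w)" (is ?D2)
    and "w * (1 - w) * (E w * (c\<^sup>2 / ((csqrt (- w))\<^sup>2 * csqrt (1 - w) ^ 3) -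
        c * (1 / (2 * csqrt (- w) ^ 3 * (csqrt (1 - w))\<^sup>2) + 3 / (2 * csqrt (- w) * csqrt (1 - w) ^ 4)) +
        3 / (4 * csqrt (1 - w) ^ 5))) +
        (1 / 2 - 2 * w) * (E w * (1 / (2 * csqrt (1 - w) ^ 3) - c / (csqrt (- w) * (csqrt (1 - w))\<^sup>2))) -
        (1 / 4 - c\<^sup>2) * hyp_exp c w = 0" (is ?ode)
proof -
  have w: "- w \<notin> \<real>\<^sub>\<le>\<^sub>0" "1 - w \<notin> \<real>\<^sub>\<le>\<^sub>0"
    using assms(2) by (auto simp: complex_nonpos_Reals_iff complex_slot_right_eq)
  have w0: "w \<noteq> 0" "1 - w \<noteq> 0" using w by auto
  define p q where "p = csqrt (- w)" and "q = csqrt (1 - w)"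
  have pq: "p \<noteq> 0" "q \<noteq> 0" "p\<^sup>2 = - w" "q\<^sup>2 = 1 - w" using w0 by (auto simp: p_def q_def)
  have q2: "q\<^sup>2 = 1 + p\<^sup>2" using pq by simp
  have "Re q > 0" unfolding q_def using w by (intro Re_csqrt_pos)
  then have pos: "Re (q + p) > 0" by (rule sqrt_sum_inverse(2)[rotated]) (simp add: pq)
  then have ln: "p + q \<notin> \<real>\<^sub>\<le>\<^sub>0" "p + q \<noteq> 0" by (auto simp: complex_nonpos_Reals_iff dest: arg_cong[of _ _ Re])
  have dp: "((\<lambda>w. csqrt (- w)) has_field_derivative - 1 / (2 * p)) (at w)"
    unfolding p_def using w by (auto intro!: derivative_eq_intros)
  have dq: "((\<lambda>w. csqrt (1 - w)) has_field_derivative - 1 / (2 * q)) (at w)"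
    unfolding q_def using w by (auto intro!: derivative_eq_intros)
  have dE: "(E has_field_derivative - (c / (p * q)) * E w) (at w)"
  proof -
    have "((\<lambda>w. Ln (csqrt (- w) + csqrt (1 - w))) has_field_derivative
        inverse (p + q) * (- 1 / (2 * p) + - 1 / (2 * q))) (at w)"
      unfolding p_def[symmetric]
      by (rule DERIV_chain2[OF has_field_derivative_Ln DERIV_add[OF dp dq], unfolded p_def[symmetric] q_def[symmetric], OF ln(1)])
    moreover have "inverse (p + q) * (- 1 / (2 * p) + - 1 / (2 * q)) = - 1 / (2 * p * q)"
    proof -
      have "- 1 / (2 * p) + - 1 / (2 * q) = (p + q) * (- 1 / (2 * p * q))"
        using pq by (simp add: field_simps)
      then show ?thesis using ln(2) by simp
    qed
    ultimately have "((\<lambda>w. Ln (csqrt (- w) + csqrt (1 - w))) has_field_derivative - 1 / (2 * p * q)) (at w)"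
      by simp
    note dL = this
    show ?thesis unfolding E_def
      by (rule DERIV_cong[OF DERIV_chain2[OF DERIV_exp DERIV_cmult[OF dL]]]) (use pq in \<open>simp add: field_simps\<close>)
  qed
  have sq: "csqrt (- w) = p" "csqrt (1 - w) = q" by (simp_all add: p_def q_def)
  have h: "hyp_exp c = (\<lambda>w. E w / csqrt (1 - w))" by (simp add: fun_eq_iff hyp_exp_def E_def)
  have "((\<lambda>w. E w / csqrt (1 - w)) has_field_derivative
     E w * (1 / (2 * q ^ 3) - c / (p * q\<^sup>2))) (at w)"
    by (rule DERIV_cong[OF DERIV_divide[OF dE dq]], unfold sq)
      (use pq(1,2) in \<open>simp_all add: field_simps power2_eq_square power3_eq_cube\<close>)
  then show ?D1 unfolding h sq .
  have "((\<lambda>w. 1 / (2 * Q w ^ 3) - c / (P w * (Q w)\<^sup>2)) has_field_derivative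
      - (3 * Q' / (2 * Q w ^ 4)) + c * (P' / ((P w)\<^sup>2 * (Q w)\<^sup>2) + 2 * Q' / (P w * Q w ^ 3))) (at w)"
    if "(P has_field_derivative P') (at w)" "(Q has_field_derivative Q') (at w)" "P w \<noteq> 0" "Q w \<noteq> 0" for P Q P' Q'
    using that by (auto intro!: derivative_eq_intros) (simp add: divide_simps, simp add: algebra_simps eval_nat_numeral)
  note dG = this[OF dp dq, unfolded sq, OF pq(1,2)]
  show ?D2 unfolding sq
    by (rule DERIV_cong[OF DERIV_mult[OF dE dG]], unfold sq)
      (use pq(1,2) in \<open>simp add: divide_simps, simp add: algebra_simps eval_nat_numeral\<close>)
  have "w * (1 - w) * (c\<^sup>2 / (p\<^sup>2 * q ^ 3) - c * (1 / (2 * p ^ 3 * q\<^sup>2) + 3 / (2 * p * q ^ 4)) + 3 / (4 * q ^ 5)) +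
        (1 / 2 - 2 * w) * (1 / (2 * q ^ 3) - c / (p * q\<^sup>2)) - (1 / 4 - c\<^sup>2) / q = 0"
  proof -
    have "w = - p\<^sup>2" "1 - w = q\<^sup>2" using pq by auto
    then have "w * (1 - w) * (c\<^sup>2 / (p\<^sup>2 * q ^ 3) - c * (1 / (2 * p ^ 3 * q\<^sup>2) + 3 / (2 * p * q ^ 4)) + 3 / (4 * q ^ 5)) +
        (1 / 2 - 2 * w) * (1 / (2 * q ^ 3) - c / (p * q\<^sup>2)) - (1 / 4 - c\<^sup>2) / q =
        - p\<^sup>2 * q\<^sup>2 * (c\<^sup>2 / (p\<^sup>2 * q ^ 3) - c * (1 / (2 * p ^ 3 * q\<^sup>2) + 3 / (2 * p * q ^ 4)) + 3 / (4 * q ^ 5)) +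
        (1 / 2 + 2 * p\<^sup>2) * (1 / (2 * q ^ 3) - c / (p * q\<^sup>2)) - (1 / 4 - c\<^sup>2) / q"
      by simp
    \<comment> \<open>Treating \<open>p\<close> and \<open>q\<close> as independent isolates the
      only relation used, \<open>q^2 = 1 + p^2\<close>.\<close>
    also have "\<dots> = c * (q\<^sup>2 - p\<^sup>2 - 1) / (2 * p * q\<^sup>2) + (1 + p\<^sup>2 - q\<^sup>2) / (4 * q ^ 3)"
      using pq(1,2) by (simp add: divide_simps) (simp add: algebra_simps eval_nat_numeral)
    also have "\<dots> = 0" using q2 by simp
    finally show ?thesis .
  qed
  then have "E w * (w * (1 - w) * (c\<^sup>2 / (p\<^sup>2 * q ^ 3) - c * (1 / (2 * p ^ 3 * q\<^sup>2) + 3 / (2 * p * q ^ 4)) + 3 / (4 * q ^ 5)) +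
        (1 / 2 - 2 * w) * (1 / (2 * q ^ 3) - c / (p * q\<^sup>2)) - (1 / 4 - c\<^sup>2) / q) = 0"
    by simp
  moreover have "W * (e * A) + B * (e * G) - D * (e / q) = e * (W * A + B * G - D / q)" for W e A B G D :: complex
    by (simp add: algebra_simps)
  ultimately show ?ode unfolding h sq by simp
qed

text \<open>Changing the sign of \<open>p\<close> replaces \<open>Ln (p + q)\<close> by its
  negative, which merely swaps the summands for \<open>c\<close> and \<open>- c\<close>; so any
  square root of \<open>- w\<close> may be used.\<close>

lemma hyp_exp_even:
  assumes "w \<notin> of_real ` {1..}" and "p\<^sup>2 = - w"
  shows "hyp_exp c w + hyp_exp (- c) w =
    (exp (2 * c * Ln (p + csqrt (1 - w))) + exp (- (2 * c * Ln (p + csqrt (1 - w))))) / csqrt (1 - w)"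
    and "p + csqrt (1 - w) \<notin> \<real>\<^sub>\<le>\<^sub>0"
proof -
  define q where "q = csqrt (1 - w)"
  have "1 - w \<notin> \<real>\<^sub>\<le>\<^sub>0"
    using assms(1) by (auto simp: complex_nonpos_Reals_iff complex_slot_right_eq)
  then have "Re q > 0" unfolding q_def by (rule Re_csqrt_pos)
  moreover have "q\<^sup>2 - p\<^sup>2 = 1" by (simp add: q_def assms(2))
  ultimately have q: "Re (q + p) > 0" "Ln (q - p) = - Ln (q + p)" by (auto dest: sqrt_sum_inverse)
  then show "p + csqrt (1 - w) \<notin> \<real>\<^sub>\<le>\<^sub>0" by (auto simp: complex_nonpos_Reals_iff q_def add.commute)
  have "(csqrt (- w))\<^sup>2 = p\<^sup>2" by (simp add: assms(2))
  then have "csqrt (- w) = p \<or> csqrt (- w) = - p" by (simp only: power2_eq_iff)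
  then show "hyp_exp c w + hyp_exp (- c) w =
    (exp (2 * c * Ln (p + csqrt (1 - w))) + exp (- (2 * c * Ln (p + csqrt (1 - w))))) / csqrt (1 - w)"
    using q(2) by (auto simp: hyp_exp_def q_def[symmetric] add_divide_distrib add.commute[of _ q])
qed

text \<open>
  Each summand jumps across \<open>[0, 1)\<close>, but the sum is even in the square root of \<open>- w\<close>, so that root may be
  replaced by \<open>\<i> * csqrt w\<close> near \<open>(0, 1)\<close>; the remaining point \<open>0\<close> is a removable singularity.
\<close>

lemma hyp_exp_sum_holomorphic:
  "(\<lambda>w. (hyp_exp c w + hyp_exp (- c) w) / 2) holomorphic_on - (of_real ` {1..})" (is "?f holomorphic_on ?C")
proof (rule no_isolated_singularity')
  have C: "open ?C" by (auto intro!: open_Compl closed_slot_right)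
  then show "open ?C" "finite {0::complex}" by auto
  let ?N = "- (of_real ` {0..}) :: complex set" and ?P = "?C - of_real ` {..0}"
  have "?f holomorphic_on ?N"
    unfolding holomorphic_on_open[OF open_Compl[OF closed_slot_right]]
    by (auto intro!: derivative_eq_intros hyp_exp_derivs(1) exI simp del: of_real_eq_0_iff)
  moreover have "?f holomorphic_on ?P"
  proof (rule holomorphic_transform)
    show "(exp (2 * c * Ln (\<i> * csqrt w + csqrt (1 - w))) + exp (- (2 * c * Ln (\<i> * csqrt w + csqrt (1 - w))))) / csqrt (1 - w) / 2 = ?f w"
      if "w \<in> ?P" for w
      using that by (subst hyp_exp_even(1)[of _ "\<i> * csqrt w"]) (auto simp: power_mult_distrib)
    have "w \<notin> \<real>\<^sub>\<le>\<^sub>0" "1 - w \<notin> \<real>\<^sub>\<le>\<^sub>0" "\<i> * csqrt w + csqrt (1 - w) \<notin> \<real>\<^sub>\<le>\<^sub>0" if "w \<in> ?P" for w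
      using that hyp_exp_even(2)[of w "\<i> * csqrt w"]
      by (auto simp: complex_nonpos_Reals_iff complex_slot_right_eq complex_slot_left_eq power_mult_distrib)
    then show "(\<lambda>w. (exp (2 * c * Ln (\<i> * csqrt w + csqrt (1 - w))) + exp (- (2 * c * Ln (\<i> * csqrt w + csqrt (1 - w))))) / csqrt (1 - w) / 2) holomorphic_on ?P"
      by (intro holomorphic_intros) auto
  qed
  ultimately have "?f holomorphic_on ?N \<union> ?P"
    by (rule holomorphic_on_Un) (auto intro!: open_Compl closed_slot_right open_Diff closed_slot_left)
  moreover have "?C - {0} \<subseteq> ?N \<union> ?P" by (auto simp: complex_slot_right_eq complex_slot_left_eq complex_eq_iff)
  ultimately show "?f holomorphic_on ?C - {0}" by (rule holomorphic_on_subset)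
  fix z :: complex assume "z \<in> {0}"
  then have [simp]: "z = 0" by simp
  \<comment> \<open>\<open>0\<close> is the branch point of the root; passing to the norm makes the
    limit independent of the branch.\<close>
  have "((\<lambda>w. norm (csqrt (- w))) \<longlongrightarrow> 0) (at 0)"
    by (auto intro!: tendsto_eq_intros)
  then have p: "((\<lambda>w. csqrt (- w)) \<longlongrightarrow> 0) (at 0)" by (rule tendsto_norm_zero_cancel)
  have "isCont (\<lambda>w. csqrt (1 - w)) 0" by (intro continuous_intros isCont_csqrt') auto
  then have q: "((\<lambda>w. csqrt (1 - w)) \<longlongrightarrow> 1) (at 0)" by (simp add: isCont_def)
  have L: "((\<lambda>w. Ln (csqrt (- w) + csqrt (1 - w))) \<longlongrightarrow> 0) (at 0)"
    by (rule tendsto_eq_rhs[OF tendsto_Ln[OF tendsto_add[OF p q]]]) auto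
  have "(?f \<longlongrightarrow> ?f 0) (at 0)"
    unfolding hyp_exp_def by (rule tendsto_eq_intros L q refl | simp)+
  then show "(?f \<longlongrightarrow> ?f z) (at z within ?C)" by (auto intro: tendsto_within_subset)
qed

text \<open>The equation is even in \<open>c\<close>, so both exponentials solve it. Their half sum
  has no odd part in \<open>csqrt (- w)\<close>, hence is the solution that is holomorphic at
  \<open>0\<close> with value \<open>1\<close>:
  \<open>cosh (c \<theta>) / cosh (\<theta>/2)\<close>.\<close>

lemma hyp2F1_half:
  assumes "w \<notin> of_real ` {1..}"
  shows "hyp2F1 (1 / 2 - c) (c + 1 / 2) (1 / 2) w = (hyp_exp c w + hyp_exp (- c) w) / 2"
proof (rule hyp2F1_eqI[where V = "- (of_real ` {0..})"])
  let ?E = "\<lambda>c w. exp (2 * c * Ln (csqrt (- w) + csqrt (1 - w)))"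
  let ?h1 = "\<lambda>c w. ?E c w * (1 / (2 * csqrt (1 - w) ^ 3) - c / (csqrt (- w) * (csqrt (1 - w))\<^sup>2))"
  let ?h2 = "\<lambda>c w. ?E c w * (c\<^sup>2 / ((csqrt (- w))\<^sup>2 * csqrt (1 - w) ^ 3) -
        c * (1 / (2 * csqrt (- w) ^ 3 * (csqrt (1 - w))\<^sup>2) + 3 / (2 * csqrt (- w) * csqrt (1 - w) ^ 4)) +
        3 / (4 * csqrt (1 - w) ^ 5))"
  let ?f' = "\<lambda>w. (?h1 c w + ?h1 (- c) w) / 2" and ?f'' = "\<lambda>w. (?h2 c w + ?h2 (- c) w) / 2"
  show "((\<lambda>w. (hyp_exp c w + hyp_exp (- c) w) / 2) has_field_derivative ?f' w) (at w)"
    if "w \<in> - of_real ` {0..}" for w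
    using that by (intro DERIV_cdivide DERIV_add hyp_exp_derivs(1)) simp_all
  show "(?f' has_field_derivative ?f'' w) (at w)" if "w \<in> - of_real ` {0..}" for w
    using that by (intro DERIV_cdivide DERIV_add hyp_exp_derivs(2)) simp_all
  show "w * (1 - w) * ?f'' w + (1 / 2 - (1 / 2 - c + (c + 1 / 2) + 1) * w) * ?f' w -
      (1 / 2 - c) * (c + 1 / 2) * ((hyp_exp c w + hyp_exp (- c) w) / 2) = 0"
    if "w \<in> - of_real ` {0..}" for w
  proof -
    have w: "w \<notin> of_real ` {0..}" using that by simp
    have "W * ((A + A') / 2) + (1 / 2 - (1 / 2 - c + (c + 1 / 2) + 1) * w) * ((B + B') / 2) -
        (1 / 2 - c) * (c + 1 / 2) * ((F + F') / 2) = 0"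
      if "W * A + (1 / 2 - 2 * w) * B - (1 / 4 - c\<^sup>2) * F = 0"
        "W * A' + (1 / 2 - 2 * w) * B' - (1 / 4 - (- c)\<^sup>2) * F' = 0" for W A B F A' B' F' :: complex
    proof -
      have "W * ((A + A') / 2) + (1 / 2 - (1 / 2 - c + (c + 1 / 2) + 1) * w) * ((B + B') / 2) -
        (1 / 2 - c) * (c + 1 / 2) * ((F + F') / 2) =
        ((W * A + (1 / 2 - 2 * w) * B - (1 / 4 - c\<^sup>2) * F) +
        (W * A' + (1 / 2 - 2 * w) * B' - (1 / 4 - (- c)\<^sup>2) * F')) / 2"
        by (simp add: field_simps power2_eq_square)
      then show ?thesis unfolding that by simp
    qed
    from this[OF hyp_exp_derivs(3)[OF w] hyp_exp_derivs(3)[OF w]] show ?thesis .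
  qed
  have "\<i> \<in> - (of_real ` {0..})" by (simp add: complex_slot_right_eq)
  then show "- (of_real ` {0::real..}) \<noteq> ({} :: complex set)" by blast
  show "1 / 2 + of_nat m \<noteq> (0::complex)" for m
  proof -
    have "Re (1 / 2 + of_nat m) > 0" by simp
    then show ?thesis by (metis less_irrefl zero_complex.sel(1))
  qed
  show "open (- (of_real ` {0::real..}) :: complex set)" by (intro open_Compl closed_slot_right)
  show "(hyp_exp c 0 + hyp_exp (- c) 0) / 2 = 1" by (simp add: hyp_exp_def)
qed (use assms hyp_exp_sum_holomorphic in auto)

text \<open>The classical evaluation of \<open>F(\<alpha>, \<alpha> + 1/2; 2 \<alpha>; w)\<close> at
  \<open>\<alpha> = (c + 1) / 2\<close>. As \<open>csqrt (1 - w)\<close> stays in the right half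
  plane, the formula and its derivatives are valid on the whole slit plane.\<close>

lemma hyp2F1_shifted_half:
  assumes "w \<notin> of_real ` {1..}" and c: "\<And>m. c + 1 + of_nat m \<noteq> 0"
  shows "hyp2F1 ((c + 2) / 2) ((c + 1) / 2) (c + 1) w =
    exp (c * (Ln 2 - Ln (1 + csqrt (1 - w)))) / csqrt (1 - w)"
proof (rule hyp2F1_eqI[where V = "- (of_real ` {1..})"])
  let ?C = "- (of_real ` {1..}) :: complex set"
  let ?E = "\<lambda>w. exp (c * (Ln 2 - Ln (1 + csqrt (1 - w))))"
  let ?q = "\<lambda>w. csqrt (1 - w)"
  let ?f' = "\<lambda>w. ?E w * (c / (2 * (?q w)\<^sup>2 * (1 + ?q w)) + 1 / (2 * ?q w ^ 3))"
  let ?f'' = "\<lambda>w. ?E w * (c\<^sup>2 / (4 * ?q w ^ 3 * (1 + ?q w)\<^sup>2) + 3 * c / (4 * ?q w ^ 4 * (1 + ?q w)) +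
    c / (4 * ?q w ^ 3 * (1 + ?q w)\<^sup>2) + 3 / (4 * ?q w ^ 5))"
  have w: "1 - w \<notin> \<real>\<^sub>\<le>\<^sub>0" "?q w \<noteq> 0" "1 + ?q w \<noteq> 0" "1 + ?q w \<notin> \<real>\<^sub>\<le>\<^sub>0" if "w \<in> ?C" for w
  proof -
    show *: "1 - w \<notin> \<real>\<^sub>\<le>\<^sub>0"
      using that by (auto simp: complex_nonpos_Reals_iff complex_slot_right_eq)
    then have "Re (?q w) > 0" by (rule Re_csqrt_pos)
    then show "?q w \<noteq> 0" and l: "1 + ?q w \<notin> \<real>\<^sub>\<le>\<^sub>0"
      by (auto simp: complex_nonpos_Reals_iff simp del: csqrt.simps)
    from l show "1 + ?q w \<noteq> 0" by auto
  qed
  have dq: "(?q has_field_derivative - 1 / (2 * ?q w)) (at w)" if "w \<in> ?C" for w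
    using w[OF that] by (auto intro!: derivative_eq_intros)
  have dE: "(?E has_field_derivative c / (2 * ?q w * (1 + ?q w)) * ?E w) (at w)" if "w \<in> ?C" for w
  proof -
    have "((\<lambda>w. 1 + ?q w) has_field_derivative - 1 / (2 * ?q w)) (at w)"
      using DERIV_add[OF DERIV_const dq[OF that]] by simp
    from DERIV_chain2[OF has_field_derivative_Ln this] w[OF that]
    have "((\<lambda>w. Ln (1 + ?q w)) has_field_derivative inverse (1 + ?q w) * (- 1 / (2 * ?q w))) (at w)" by simp
    from DERIV_cmult[OF DERIV_diff[OF DERIV_const this], of c "Ln 2"]
    show ?thesis
      by (rule DERIV_cong[OF DERIV_chain2[OF DERIV_exp]]) (use w[OF that] in \<open>simp add: field_simps\<close>)
  qed
  show f': "((\<lambda>w. ?E w / ?q w) has_field_derivative ?f' w) (at w)" if "w \<in> ?C" for w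
  proof (rule DERIV_cong[OF DERIV_divide[OF dE[OF that] dq[OF that] w(2)[OF that]]])
    have "(c / (2 * q * q1) * e * q - e * (- 1 / (2 * q))) / (q * q) = e * (c / (2 * q\<^sup>2 * q1) + 1 / (2 * q ^ 3))"
      if "q \<noteq> 0" "q1 \<noteq> 0" for q q1 e :: complex
      using that by (simp add: field_simps eval_nat_numeral)
    from this[OF w(2,3)[OF that]]
    show "(c / (2 * ?q w * (1 + ?q w)) * ?E w * ?q w - ?E w * (- 1 / (2 * ?q w))) / (?q w * ?q w) = ?f' w" .
  qed
  show "(?f' has_field_derivative ?f'' w) (at w)" if "w \<in> ?C" for w
  proof -
    have "((\<lambda>w. c / (2 * (Q w)\<^sup>2 * (1 + Q w)) + 1 / (2 * Q w ^ 3)) has_field_derivative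
        - (c * Q' * (1 / (Q w ^ 3 * (1 + Q w)) + 1 / (2 * (Q w)\<^sup>2 * (1 + Q w)\<^sup>2)) + 3 * Q' / (2 * Q w ^ 4))) (at w)"
      if "(Q has_field_derivative Q') (at w)" "Q w \<noteq> 0" "1 + Q w \<noteq> 0" for Q Q'
    proof -
      have *: "((\<lambda>w. 2 * (Q w)\<^sup>2 * (1 + Q w)) has_field_derivative (4 * Q w * (1 + Q w) + 2 * (Q w)\<^sup>2) * Q') (at w)"
        by (auto intro!: derivative_eq_intros that(1) simp: algebra_simps power2_eq_square)
      have **: "((\<lambda>w. 2 * Q w ^ 3) has_field_derivative 6 * (Q w)\<^sup>2 * Q') (at w)"
        by (auto intro!: derivative_eq_intros that(1) simp: algebra_simps)
      have alg: "(0 * (2 * q\<^sup>2 * q1) - c * ((4 * q * q1 + 2 * q\<^sup>2) * Q')) / (2 * q\<^sup>2 * q1 * (2 * q\<^sup>2 * q1)) +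
          (0 * (2 * q ^ 3) - 1 * (6 * q\<^sup>2 * Q')) / (2 * q ^ 3 * (2 * q ^ 3)) =
          - (c * Q' * (1 / (q ^ 3 * q1) + 1 / (2 * q\<^sup>2 * q1\<^sup>2)) + 3 * Q' / (2 * q ^ 4))"
        if "q \<noteq> 0" "q1 \<noteq> 0" for q q1 :: complex
        using that by (simp add: divide_simps) (simp add: algebra_simps eval_nat_numeral)
      show ?thesis
        by (rule DERIV_cong[OF DERIV_add[OF DERIV_divide[OF DERIV_const *] DERIV_divide[OF DERIV_const **]] alg])
           (use that in auto)
    qed
    note dG = this[OF dq[OF that] w(2,3)[OF that]]
    have "c / (2 * q * q1) * e * (c / (2 * q\<^sup>2 * q1) + 1 / (2 * q ^ 3)) +
        - (c * (- 1 / (2 * q)) * (1 / (q ^ 3 * q1) + 1 / (2 * q\<^sup>2 * q1\<^sup>2)) + 3 * (- 1 / (2 * q)) / (2 * q ^ 4)) * e =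
        e * (c\<^sup>2 / (4 * q ^ 3 * q1\<^sup>2) + 3 * c / (4 * q ^ 4 * q1) + c / (4 * q ^ 3 * q1\<^sup>2) + 3 / (4 * q ^ 5))"
      if "q \<noteq> 0" "q1 \<noteq> 0" for q q1 e :: complex
      using that by (simp add: divide_simps) (simp add: algebra_simps eval_nat_numeral)
    from DERIV_cong[OF DERIV_mult[OF dE[OF that] dG] this[OF w(2,3)[OF that]]] show ?thesis .
  qed
  show "w * (1 - w) * ?f'' w + (c + 1 - ((c + 2) / 2 + (c + 1) / 2 + 1) * w) * ?f' w -
      (c + 2) / 2 * ((c + 1) / 2) * (?E w / ?q w) = 0" if "w \<in> ?C" for w
  proof -
    \<comment> \<open>Writing \<open>w = 1 - q^2\<close> turns the equation into a rational identity
      in \<open>q\<close>, with the exponential as a common factor \<open>e\<close>.\<close>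
    have "(1 - q\<^sup>2) * q\<^sup>2 * (e * (c\<^sup>2 / (4 * q ^ 3 * (1 + q)\<^sup>2) + 3 * c / (4 * q ^ 4 * (1 + q)) + c / (4 * q ^ 3 * (1 + q)\<^sup>2) + 3 / (4 * q ^ 5))) +
       (c + 1 - ((c + 2) / 2 + (c + 1) / 2 + 1) * (1 - q\<^sup>2)) * (e * (c / (2 * q\<^sup>2 * (1 + q)) + 1 / (2 * q ^ 3))) -
       (c + 2) / 2 * ((c + 1) / 2) * (e / q) = 0"
      if "q \<noteq> 0" "1 + q \<noteq> 0" for q e :: complex
      using that by (simp add: divide_simps) (simp add: algebra_simps eval_nat_numeral)
    from this[OF w(2,3)[OF that], of "?E w"] show ?thesis by simp
  qed
  show "(\<lambda>w. ?E w / ?q w) holomorphic_on ?C"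
    using f' by (auto simp: holomorphic_on_open open_Compl closed_slot_right)
  show "open ?C" by (intro open_Compl closed_slot_right)
  show "?C \<noteq> {}" using assms(1) by blast
qed (use assms in auto)

subsection \<open>Legendre functions of order one half\<close>

text \<open>Up to a constant factor this is \<open>exp (c \<theta>) / sqrt (sinh \<theta>)\<close> for \<open>z = cosh \<theta>\<close>.\<close>

definition legendre_exp :: "complex \<Rightarrow> complex \<Rightarrow> complex" where
  "legendre_exp c z = exp (2 * c * Ln (csqrt ((z - 1) / 2) + csqrt ((z + 1) / 2)) -
     (Ln ((z - 1) / 2) + Ln ((z + 1) / 2)) / 4)"

lemma legendre_cut_plane_iff: "z \<in> legendre_cut_plane \<longleftrightarrow> Re z > 1 \<or> Im z \<noteq> 0"
  by (auto simp: legendre_cut_plane_def complex_slot_left_eq)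

lemma connected_legendre_cut_plane: "connected legendre_cut_plane"
  unfolding legendre_cut_plane_def by (intro starlike_imp_connected starlike_slotted_complex_plane_left)

context
  fixes z assumes z: "z \<in> legendre_cut_plane"
begin

lemma legendre_cut_plane_nonpos: "(z - 1) / 2 \<notin> \<real>\<^sub>\<le>\<^sub>0" "(z + 1) / 2 \<notin> \<real>\<^sub>\<le>\<^sub>0" "z \<notin> \<real>\<^sub>\<le>\<^sub>0"
  using z by (auto simp: complex_nonpos_Reals_iff legendre_cut_plane_iff)

text \<open>For \<open>z = cosh \<theta>\<close> the factors are \<open>sinh (\<theta>/2)\<close>
  and \<open>cosh (\<theta>/2)\<close>, so twice their product is \<open>sinh \<theta>\<close>.
  Unlike \<open>csqrt (z^2 - 1)\<close>, it does not jump across the imaginary axis.\<close>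

lemma legendre_cut_plane_square: "z\<^sup>2 - 1 = (2 * (csqrt ((z - 1) / 2) * csqrt ((z + 1) / 2)))\<^sup>2"
  by (simp add: power_mult_distrib) (simp add: algebra_simps power2_eq_square)

lemma legendre_cut_plane_square_neq_0: "z\<^sup>2 - 1 \<noteq> 0"
proof -
  have "(z - 1) / 2 \<noteq> 0" "(z + 1) / 2 \<noteq> 0" using legendre_cut_plane_nonpos by auto
  then show ?thesis unfolding legendre_cut_plane_square by simp
qed

text \<open>The logarithm is \<open>\<theta>/2\<close> and has derivative
  \<open>1 / (4 p q)\<close>, with \<open>p\<close>, \<open>q\<close> the two roots; the fourth root
  of \<open>(z^2 - 1) / 4\<close> contributes the other term.\<close>

lemma DERIV_legendre_exp:
  "(legendre_exp c has_field_derivative legendre_exp c z *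
     (c / (2 * (csqrt ((z - 1) / 2) * csqrt ((z + 1) / 2))) - z / (2 * (z\<^sup>2 - 1)))) (at z)"
proof -
  define p q where "p = csqrt ((z - 1) / 2)" and "q = csqrt ((z + 1) / 2)"
  note nr = legendre_cut_plane_nonpos
  have "(z - 1) / 2 \<noteq> 0" "(z + 1) / 2 \<noteq> 0" using nr by auto
  then have pq: "p \<noteq> 0" "q \<noteq> 0" "z - 1 \<noteq> 0" "z + 1 \<noteq> 0" by (auto simp: p_def q_def)
  have pos: "Re (p + q) > 0" unfolding p_def q_def plus_complex.sel using nr by (intro add_pos_pos Re_csqrt_pos)
  then have ln: "p + q \<notin> \<real>\<^sub>\<le>\<^sub>0" "p + q \<noteq> 0" by (auto simp: complex_nonpos_Reals_iff dest: arg_cong[of _ _ Re])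
  have dp: "((\<lambda>z. csqrt ((z - 1) / 2)) has_field_derivative 1 / (4 * p)) (at z)"
    unfolding p_def using nr by (auto intro!: derivative_eq_intros)
  have dq: "((\<lambda>z. csqrt ((z + 1) / 2)) has_field_derivative 1 / (4 * q)) (at z)"
    unfolding q_def using nr by (auto intro!: derivative_eq_intros)
  from DERIV_chain2[OF has_field_derivative_Ln DERIV_add[OF dp dq]] ln(1)
  have "((\<lambda>z. Ln (csqrt ((z - 1) / 2) + csqrt ((z + 1) / 2))) has_field_derivative
      inverse (p + q) * (1 / (4 * p) + 1 / (4 * q))) (at z)" by (simp add: p_def q_def)
  moreover have "inverse (p + q) * (1 / (4 * p) + 1 / (4 * q)) = 1 / (4 * (p * q))"
  proof -
    have "1 / (4 * p) + 1 / (4 * q) = (p + q) * (1 / (4 * (p * q)))" using pq by (simp add: field_simps)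
    then show ?thesis using ln(2) by simp
  qed
  ultimately have dL: "((\<lambda>z. Ln (csqrt ((z - 1) / 2) + csqrt ((z + 1) / 2))) has_field_derivative 1 / (4 * (p * q))) (at z)"
    by simp
  have "((\<lambda>z. Ln ((z - 1) / 2)) has_field_derivative 1 / (z - 1)) (at z)"
    "((\<lambda>z. Ln ((z + 1) / 2)) has_field_derivative 1 / (z + 1)) (at z)"
  proof -
    have d: "((\<lambda>z. (z - 1) / 2) has_field_derivative 1 / 2) (at z)" "((\<lambda>z. (z + 1) / 2) has_field_derivative 1 / 2) (at z)"
      by (auto intro!: derivative_eq_intros)
    have alg: "inverse (t / 2) * (1 / 2) = 1 / t" for t :: complex by (cases "t = 0") (simp_all add: field_simps)
    show "((\<lambda>z. Ln ((z - 1) / 2)) has_field_derivative 1 / (z - 1)) (at z)"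
      by (rule DERIV_cong[OF DERIV_chain2[OF has_field_derivative_Ln[OF nr(1)] d(1)] alg])
    show "((\<lambda>z. Ln ((z + 1) / 2)) has_field_derivative 1 / (z + 1)) (at z)"
      by (rule DERIV_cong[OF DERIV_chain2[OF has_field_derivative_Ln[OF nr(2)] d(2)] alg])
  qed
  then have "((\<lambda>z. (Ln ((z - 1) / 2) + Ln ((z + 1) / 2)) / 4) has_field_derivative (1 / (z - 1) + 1 / (z + 1)) / 4) (at z)"
    by (intro DERIV_cdivide DERIV_add)
  moreover have "(1 / (z - 1) + 1 / (z + 1)) / 4 = z / (2 * (z\<^sup>2 - 1))"
  proof -
    have "z\<^sup>2 - 1 = (z - 1) * (z + 1)" by (simp add: algebra_simps power2_eq_square)
    then show ?thesis using pq by (simp add: divide_simps)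
  qed
  ultimately have d2: "((\<lambda>z. (Ln ((z - 1) / 2) + Ln ((z + 1) / 2)) / 4) has_field_derivative z / (2 * (z\<^sup>2 - 1))) (at z)"
    by simp
  have "legendre_exp c = (\<lambda>z. exp (2 * c * Ln (csqrt ((z - 1) / 2) + csqrt ((z + 1) / 2)) -
     (Ln ((z - 1) / 2) + Ln ((z + 1) / 2)) / 4))" by (simp add: fun_eq_iff legendre_exp_def)
  then show ?thesis
    unfolding p_def[symmetric] q_def[symmetric]
    using DERIV_chain2[OF DERIV_exp DERIV_diff[OF DERIV_cmult[OF dL] d2], of "2 * c"] by simp
qed

text \<open>If \<open>y' = y D\<close> then \<open>y'' = y (D^2 + D')\<close>; the derivative of
  \<open>R = 2 p q\<close> is \<open>z / R\<close>.\<close>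

lemma DERIV_legendre_exp_2:
  "((\<lambda>z. legendre_exp c z *
     (c / (2 * (csqrt ((z - 1) / 2) * csqrt ((z + 1) / 2))) - z / (2 * (z\<^sup>2 - 1)))) has_field_derivative
    legendre_exp c z * ((c / (2 * (csqrt ((z - 1) / 2) * csqrt ((z + 1) / 2))) - z / (2 * (z\<^sup>2 - 1)))\<^sup>2 -
      c * z / (2 * (csqrt ((z - 1) / 2) * csqrt ((z + 1) / 2))) ^ 3 - 1 / (2 * (z\<^sup>2 - 1)) + z\<^sup>2 / (z\<^sup>2 - 1)\<^sup>2)) (at z)"
proof -
  let ?R = "\<lambda>z. 2 * (csqrt ((z - 1) / 2) * csqrt ((z + 1) / 2))"
  define p q where "p = csqrt ((z - 1) / 2)" and "q = csqrt ((z + 1) / 2)"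
  note nr = legendre_cut_plane_nonpos
  have "(z - 1) / 2 \<noteq> 0" "(z + 1) / 2 \<noteq> 0" using nr by auto
  then have pq: "p \<noteq> 0" "q \<noteq> 0" "p\<^sup>2 = (z - 1) / 2" "q\<^sup>2 = (z + 1) / 2" by (auto simp: p_def q_def)
  have dp: "((\<lambda>z. csqrt ((z - 1) / 2)) has_field_derivative 1 / (4 * p)) (at z)"
    unfolding p_def using nr by (auto intro!: derivative_eq_intros)
  have dq: "((\<lambda>z. csqrt ((z + 1) / 2)) has_field_derivative 1 / (4 * q)) (at z)"
    unfolding q_def using nr by (auto intro!: derivative_eq_intros)
  have R: "?R z = 2 * (p * q)" by (simp add: p_def q_def)
  have R0: "?R z \<noteq> 0" using pq by (simp add: R)
  have dR: "(?R has_field_derivative z / ?R z) (at z)"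
  proof (rule DERIV_cong[OF DERIV_cmult[OF DERIV_mult[OF dp dq]]])
    have "2 * (1 / (4 * p) * q + 1 / (4 * q) * p) = (q\<^sup>2 + p\<^sup>2) / (2 * (p * q))"
      using pq(1,2) by (simp add: field_simps power2_eq_square)
    also have "q\<^sup>2 + p\<^sup>2 = z" unfolding pq by (simp add: field_simps)
    finally show "2 * (1 / (4 * p) * csqrt ((z + 1) / 2) + 1 / (4 * q) * csqrt ((z - 1) / 2)) = z / ?R z"
      unfolding R by (simp add: p_def q_def)
  qed
  have "((\<lambda>z. c / Q z) has_field_derivative - (c * Q' / (Q z)\<^sup>2)) (at z)"
    if "(Q has_field_derivative Q') (at z)" "Q z \<noteq> 0" for Q Q'
    using that by (auto intro!: derivative_eq_intros simp: power2_eq_square)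
  from this[OF dR R0] have d1: "((\<lambda>z. c / ?R z) has_field_derivative - (c * z / ?R z ^ 3)) (at z)"
    by (rule DERIV_cong) (use R0 in \<open>simp add: power2_eq_square power3_eq_cube\<close>)
  have alg: "(1 * (2 * X) - z * (2 * (2 * z))) / (2 * X * (2 * X)) = 1 / (2 * X) - z\<^sup>2 / X\<^sup>2" if "X \<noteq> 0" for X
    using that by (simp add: field_simps power2_eq_square)
  have "((\<lambda>z. 2 * (z\<^sup>2 - 1)) has_field_derivative 2 * (2 * z)) (at z)" by (auto intro!: derivative_eq_intros)
  from DERIV_divide[OF DERIV_ident this] legendre_cut_plane_square_neq_0
  have d2: "((\<lambda>z. z / (2 * (z\<^sup>2 - 1))) has_field_derivative 1 / (2 * (z\<^sup>2 - 1)) - z\<^sup>2 / (z\<^sup>2 - 1)\<^sup>2) (at z)"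
    unfolding alg[OF legendre_cut_plane_square_neq_0] by simp
  have alg2: "y * D * D + (- A - (B - G)) * y = y * (D\<^sup>2 - A - B + G)" for y A B G D :: complex
    by (simp add: algebra_simps power2_eq_square)
  show ?thesis
    by (rule DERIV_cong[OF DERIV_mult[OF DERIV_legendre_exp DERIV_diff[OF d1 d2]] alg2])
qed

lemma legendre_exp_ode:
  "(z\<^sup>2 - 1)\<^sup>2 * (legendre_exp c z * ((c / (2 * (csqrt ((z - 1) / 2) * csqrt ((z + 1) / 2))) - z / (2 * (z\<^sup>2 - 1)))\<^sup>2 -
      c * z / (2 * (csqrt ((z - 1) / 2) * csqrt ((z + 1) / 2))) ^ 3 - 1 / (2 * (z\<^sup>2 - 1)) + z\<^sup>2 / (z\<^sup>2 - 1)\<^sup>2)) +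
    2 * z * (z\<^sup>2 - 1) * (legendre_exp c z *
      (c / (2 * (csqrt ((z - 1) / 2) * csqrt ((z + 1) / 2))) - z / (2 * (z\<^sup>2 - 1)))) -
    ((c\<^sup>2 - 1 / 4) * (z\<^sup>2 - 1) + 1 / 4) * legendre_exp c z = 0"
proof -
  define R where "R = 2 * (csqrt ((z - 1) / 2) * csqrt ((z + 1) / 2))"
  have R2: "z\<^sup>2 - 1 = R\<^sup>2" unfolding R_def by (rule legendre_cut_plane_square)
  have R0: "R \<noteq> 0" using legendre_cut_plane_square_neq_0 R2 by auto
  \<comment> \<open>With \<open>z\<close> and \<open>R\<close> independent, all terms containing
    \<open>c\<close> cancel and a multiple of \<open>z^2 - 1 - R^2\<close> is left.\<close>
  have "(R\<^sup>2)\<^sup>2 * (y * ((c / R - z / (2 * R\<^sup>2))\<^sup>2 - c * z / R ^ 3 - 1 / (2 * R\<^sup>2) + z\<^sup>2 / (R\<^sup>2)\<^sup>2)) +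
      2 * z * R\<^sup>2 * (y * (c / R - z / (2 * R\<^sup>2))) - ((c\<^sup>2 - 1 / 4) * R\<^sup>2 + 1 / 4) * y = (z\<^sup>2 - 1 - R\<^sup>2) / 4 * y" for y
    using R0 by (simp add: divide_simps) (simp add: algebra_simps eval_nat_numeral)
  then show ?thesis unfolding R_def[symmetric] R2 by (simp add: R2)
qed

end

lemma legendre_exp_holomorphic: "legendre_exp c holomorphic_on legendre_cut_plane"
  using DERIV_legendre_exp by (auto simp: holomorphic_on_open open_legendre_cut_plane)

lemma deriv_legendre_exp_combination:
  fixes A B c :: complex
  assumes z: "z \<in> legendre_cut_plane"
  defines "f \<equiv> \<lambda>z. A * legendre_exp c z + B * legendre_exp (- c) z"
  defines "R \<equiv> 2 * (csqrt ((z - 1) / 2) * csqrt ((z + 1) / 2))"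
  shows "deriv f z = A * (legendre_exp c z * (c / R - z / (2 * (z\<^sup>2 - 1)))) +
    B * (legendre_exp (- c) z * (- c / R - z / (2 * (z\<^sup>2 - 1))))"
  unfolding f_def R_def
  by (intro DERIV_imp_deriv DERIV_add DERIV_cmult DERIV_legendre_exp z)

lemma legendre_equation_legendre_exp:
  assumes \<nu>: "\<nu> = c - 1 / 2"
  shows "legendre_equation_on \<nu> (1 / 2) legendre_cut_plane (\<lambda>z. A * legendre_exp c z + B * legendre_exp (- c) z)"
  unfolding legendre_equation_on_def
proof (intro conjI ballI)
  let ?f = "\<lambda>z. A * legendre_exp c z + B * legendre_exp (- c) z"
  show "?f holomorphic_on legendre_cut_plane" by (intro holomorphic_intros legendre_exp_holomorphic)
  fix z assume z: "z \<in> legendre_cut_plane"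
  let ?y1 = "\<lambda>c z. legendre_exp c z * (c / (2 * (csqrt ((z - 1) / 2) * csqrt ((z + 1) / 2))) - z / (2 * (z\<^sup>2 - 1)))"
  let ?y2 = "\<lambda>c z. legendre_exp c z * ((c / (2 * (csqrt ((z - 1) / 2) * csqrt ((z + 1) / 2))) - z / (2 * (z\<^sup>2 - 1)))\<^sup>2 -
      c * z / (2 * (csqrt ((z - 1) / 2) * csqrt ((z + 1) / 2))) ^ 3 - 1 / (2 * (z\<^sup>2 - 1)) + z\<^sup>2 / (z\<^sup>2 - 1)\<^sup>2)"
  have "deriv (deriv ?f) z = deriv (\<lambda>z. A * ?y1 c z + B * ?y1 (- c) z) z"
    by (rule deriv_eq_on_open[OF open_legendre_cut_plane _ z], rule deriv_legendre_exp_combination)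
  also have "\<dots> = A * ?y2 c z + B * ?y2 (- c) z"
    by (intro DERIV_imp_deriv DERIV_add DERIV_cmult DERIV_legendre_exp_2 z)
  finally have dd: "deriv (deriv ?f) z = A * ?y2 c z + B * ?y2 (- c) z" .
  have alg: "X * (A * u2 + B * v2) + Y * (A * u1 + B * v1) - (\<nu> * (\<nu> + 1) * w + (1 / 2)\<^sup>2) * (A * u0 + B * v0) = 0"
    if "X * u2 + Y * u1 - ((c\<^sup>2 - 1 / 4) * w + 1 / 4) * u0 = 0"
       "X * v2 + Y * v1 - (((- c)\<^sup>2 - 1 / 4) * w + 1 / 4) * v0 = 0"
    for X Y u0 u1 u2 v0 v1 v2 w :: complex
  proof -
    have \<nu>2: "\<nu> * (\<nu> + 1) = c\<^sup>2 - 1 / 4" by (simp add: \<nu> field_simps power2_eq_square)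
    have "X * (A * u2 + B * v2) + Y * (A * u1 + B * v1) - (\<nu> * (\<nu> + 1) * w + (1 / 2)\<^sup>2) * (A * u0 + B * v0) =
      A * (X * u2 + Y * u1 - ((c\<^sup>2 - 1 / 4) * w + 1 / 4) * u0) +
      B * (X * v2 + Y * v1 - (((- c)\<^sup>2 - 1 / 4) * w + 1 / 4) * v0)"
      unfolding \<nu>2 by (simp add: algebra_simps power2_eq_square)
    then show ?thesis unfolding that by simp
  qed
  show "(z\<^sup>2 - 1)\<^sup>2 * deriv (deriv ?f) z + 2 * z * (z\<^sup>2 - 1) * deriv ?f z -
      (\<nu> * (\<nu> + 1) * (z\<^sup>2 - 1) + (1 / 2)\<^sup>2) * ?f z = 0"
    unfolding dd deriv_legendre_exp_combination[OF z]
    by (rule alg[OF legendre_exp_ode[OF z] legendre_exp_ode[OF z]])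
qed

text \<open>The parts depending on \<open>c\<close> cancel, and the two fourth roots combine to the
  inverse of the product of square roots. This is what makes the scaled Wronskian constant.\<close>

lemma legendre_exp_mult_minus:
  assumes z: "z \<in> legendre_cut_plane"
  shows "csqrt ((z - 1) / 2) * csqrt ((z + 1) / 2) * (legendre_exp c z * legendre_exp (- c) z) = 1"
proof -
  have "(z - 1) / 2 \<noteq> 0" "(z + 1) / 2 \<noteq> 0" using legendre_cut_plane_nonpos[OF z] by auto
  then have "csqrt ((z - 1) / 2) = exp (Ln ((z - 1) / 2) / 2)" "csqrt ((z + 1) / 2) = exp (Ln ((z + 1) / 2) / 2)"
    by (auto intro!: csqrt_exp_Ln)
  then have *: "csqrt ((z - 1) / 2) * csqrt ((z + 1) / 2) = exp (Ln ((z - 1) / 2) / 2 + Ln ((z + 1) / 2) / 2)"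
    by (simp only: exp_add)
  define L M N where "L = Ln (csqrt ((z - 1) / 2) + csqrt ((z + 1) / 2))"
    and "M = Ln ((z - 1) / 2)" and "N = Ln ((z + 1) / 2)"
  have "exp (M / 2 + N / 2) * (exp (2 * c * L - (M + N) / 4) * exp (2 * - c * L - (M + N) / 4)) = 1"
    by (simp add: exp_add[symmetric] field_simps)
  then show ?thesis unfolding legendre_exp_def L_def[symmetric] unfolding * unfolding M_def N_def .
qed

text \<open>The shape of the pair anticipates the closed forms of \<open>legendreP\<close> and
  \<open>legendreQ\<close>. With \<open>u\<close>, \<open>v\<close> the exponentials for
  \<open>c\<close> and \<open>- c\<close>, \<open>R^2 W(u, v) = - 2 c R u v\<close> and
  \<open>R u v = 2\<close>.\<close>

lemma legendre_pair_legendre_exp: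
  assumes \<nu>: "\<nu> = c - 1 / 2"
  shows "legendre_pair_on \<nu> (1 / 2) (- 4 * c * A * B) legendre_cut_plane
    (\<lambda>z. A * legendre_exp c z + A * legendre_exp (- c) z) (\<lambda>z. B * legendre_exp (- c) z)"
  unfolding legendre_pair_on_def
proof (intro conjI ballI)
  show "legendre_equation_on \<nu> (1 / 2) legendre_cut_plane (\<lambda>z. A * legendre_exp c z + A * legendre_exp (- c) z)"
    by (rule legendre_equation_legendre_exp[OF \<nu>])
  show "legendre_equation_on \<nu> (1 / 2) legendre_cut_plane (\<lambda>z. B * legendre_exp (- c) z)"
    using legendre_equation_legendre_exp[OF \<nu>, of 0 B] by simp
  fix z assume z: "z \<in> legendre_cut_plane"
  define R where "R = 2 * (csqrt ((z - 1) / 2) * csqrt ((z + 1) / 2))"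
  have R2: "z\<^sup>2 - 1 = R\<^sup>2" unfolding R_def by (rule legendre_cut_plane_square[OF z])
  have R0: "R \<noteq> 0" using legendre_cut_plane_square_neq_0[OF z] R2 by auto
  have e: "R * (legendre_exp c z * legendre_exp (- c) z) = 2"
    using legendre_exp_mult_minus[OF z, of c] by (simp add: R_def mult.assoc)
  have dQ: "deriv (\<lambda>z. B * legendre_exp (- c) z) z = B * (legendre_exp (- c) z * (- c / R - z / (2 * R\<^sup>2)))"
    using deriv_legendre_exp_combination[OF z, of 0 c B] by (simp add: R_def[symmetric] R2)
  have dP: "deriv (\<lambda>z. A * legendre_exp c z + A * legendre_exp (- c) z) z =
      A * (legendre_exp c z * (c / R - z / (2 * R\<^sup>2))) + A * (legendre_exp (- c) z * (- c / R - z / (2 * R\<^sup>2)))"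
    using deriv_legendre_exp_combination[OF z, of A c A] by (simp add: R_def[symmetric] R2)
  have "R\<^sup>2 * ((A * u + A * v) * (B * (v * (- c / R - t))) - (A * (u * (c / R - t)) + A * (v * (- c / R - t))) * (B * v)) =
      - 2 * c * A * B * (R * (u * v))" for u v t
    using R0 by (simp add: field_simps power2_eq_square)
  then show "(z\<^sup>2 - 1) * ((A * legendre_exp c z + A * legendre_exp (- c) z) * deriv (\<lambda>z. B * legendre_exp (- c) z) z -
      deriv (\<lambda>z. A * legendre_exp c z + A * legendre_exp (- c) z) z * (B * legendre_exp (- c) z)) = - 4 * c * A * B"
    unfolding dQ dP R2 by (rule trans) (simp add: e)
qed

section \<open>Identification of P and Q on the cut plane\<close>

lemma hyp2F1_half_holomorphic:
  "hyp2F1 (1 / 2 - c) (c + 1 / 2) (1 / 2) holomorphic_on - (of_real ` {1..})"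
  by (rule holomorphic_transform[OF hyp_exp_sum_holomorphic[of c]]) (simp add: hyp2F1_half)

lemma hyp2F1_shifted_half_holomorphic:
  assumes c: "\<And>m. c + 1 + of_nat m \<noteq> 0"
  shows "hyp2F1 ((c + 2) / 2) ((c + 1) / 2) (c + 1) holomorphic_on - (of_real ` {1..})"
proof (rule holomorphic_transform)
  have *: "1 - w \<notin> \<real>\<^sub>\<le>\<^sub>0" if "w \<in> - (of_real ` {1..})" for w :: complex
    using that by (auto simp: complex_nonpos_Reals_iff complex_slot_right_eq)
  have "1 + csqrt (1 - w) \<notin> \<real>\<^sub>\<le>\<^sub>0" "csqrt (1 - w) \<noteq> 0" if "w \<in> - (of_real ` {1..})" for w :: complex
    using Re_csqrt_pos[OF *[OF that]] by (auto simp: complex_nonpos_Reals_iff simp del: csqrt.simps)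
  with * show "(\<lambda>w. exp (c * (Ln 2 - Ln (1 + csqrt (1 - w)))) / csqrt (1 - w)) holomorphic_on - (of_real ` {1..})"
    by (intro holomorphic_intros) auto
qed (simp add: hyp2F1_shifted_half c)

text \<open>For real \<open>x > 1\<close> all roots, powers and logarithms in question are real, so
  identities can be checked there without tracking branches; the identity theorem extends
  them.\<close>

lemma holomorphic_eq_of_real_cut_plane:
  assumes "f holomorphic_on legendre_cut_plane" "g holomorphic_on legendre_cut_plane"
    and "\<And>x::real. x > 1 \<Longrightarrow> f (of_real x) = g (of_real x)" and "z \<in> legendre_cut_plane"
  shows "f z = g z"
proof -
  have lim: "(2 :: complex) islimpt of_real ` {1<..}"
  proof (rule islimpt_approachable[THEN iffD2], intro allI impI)
    fix e :: real assume e: "e > 0"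
    have eq: "complex_of_real (2 + e / 2) - 2 = of_real (e / 2)" by simp
    have "dist (complex_of_real (2 + e / 2)) 2 < e" "complex_of_real (2 + e / 2) \<noteq> 2"
      using e unfolding dist_norm eq norm_of_real by (auto simp: complex_eq_iff)
    moreover have "complex_of_real (2 + e / 2) \<in> of_real ` {1<..}" using e by (intro imageI) simp
    ultimately show "\<exists>x'\<in>complex_of_real ` {1<..}. x' \<noteq> 2 \<and> dist x' 2 < e" by blast
  qed
  have "f z - g z = 0"
  proof (rule analytic_continuation[OF _ open_legendre_cut_plane connected_legendre_cut_plane _ _ lim _ assms(4)])
    show "(\<lambda>z. f z - g z) holomorphic_on legendre_cut_plane" by (intro holomorphic_intros assms)
    show "of_real ` {1<..} \<subseteq> legendre_cut_plane" "2 \<in> legendre_cut_plane"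
      by (auto simp: legendre_cut_plane_iff)
    show "f w - g w = 0" if "w \<in> of_real ` {1<..}" for w
      using that assms(3) by auto
  qed
  then show ?thesis by simp
qed

lemma legendre_exp_of_real:
  assumes "x > 1"
  shows "legendre_exp (of_real c) (of_real x) = of_real (exp (2 * c * ln (sqrt ((x - 1) / 2) + sqrt ((x + 1) / 2)) -
     (ln ((x - 1) / 2) + ln ((x + 1) / 2)) / 4))"
proof -
  define A B where "A = (x - 1) / 2" and "B = (x + 1) / 2"
  have AB: "A > 0" "B > 0" using assms by (auto simp: A_def B_def)
  have e: "(of_real x - 1) / 2 = complex_of_real A" "(of_real x + 1) / 2 = complex_of_real B"
    by (simp_all add: A_def B_def)
  have s: "sqrt A + sqrt B > 0" using AB by (simp add: add_pos_pos)
  have "legendre_exp (of_real c) (of_real x) = exp (2 * of_real c * Ln (of_real (sqrt A + sqrt B)) - (Ln (of_real A) + Ln (of_real B)) / 4)"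
    unfolding legendre_exp_def e using AB by (simp add: csqrt_of_real)
  also have "\<dots> = of_real (exp (2 * c * ln (sqrt A + sqrt B) - (ln A + ln B) / 4))"
    unfolding Ln_of_real[OF s] Ln_of_real[OF AB(1)] Ln_of_real[OF AB(2)] by (simp flip: exp_of_real)
  finally show ?thesis unfolding A_def B_def .
qed

lemma legendre_cut_plane_arguments:
  assumes "z \<in> legendre_cut_plane"
  shows "(1 - z) / 2 \<notin> of_real ` {1..}" "1 / z\<^sup>2 \<notin> of_real ` {1..}" "(z + 1) / (z - 1) \<notin> \<real>\<^sub>\<le>\<^sub>0"
    "z - 1 \<notin> \<real>\<^sub>\<le>\<^sub>0" "z + 1 \<notin> \<real>\<^sub>\<le>\<^sub>0" "z \<noteq> 0"
proof -
  show "(1 - z) / 2 \<notin> of_real ` {1..}" "z - 1 \<notin> \<real>\<^sub>\<le>\<^sub>0" "z + 1 \<notin> \<real>\<^sub>\<le>\<^sub>0" and z0: "z \<noteq> 0"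
    using assms by (auto simp: complex_slot_right_eq complex_nonpos_Reals_iff legendre_cut_plane_iff)
  have real: "z \<notin> of_real ` {..1}" using assms by (simp add: legendre_cut_plane_def)
  show "1 / z\<^sup>2 \<notin> of_real ` {1..}"
  proof
    assume "1 / z\<^sup>2 \<in> of_real ` {1..}"
    then obtain t where t: "t \<ge> 1" "1 / z\<^sup>2 = of_real t" by auto
    then have "z\<^sup>2 = of_real (1 / t)" using z0 by (auto simp: field_simps)
    also have "\<dots> = (of_real (sqrt (1 / t)))\<^sup>2" using t(1) by (simp flip: of_real_power)
    finally have "z = of_real (sqrt (1 / t)) \<or> z = of_real (- sqrt (1 / t))"
      by (simp only: power2_eq_iff of_real_minus)
    moreover have "sqrt (1 / t) \<le> 1" "- sqrt (1 / t) \<le> 1"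
      using t(1) by (auto intro: order_trans[of _ 0])
    ultimately show False using real by blast
  qed
  show "(z + 1) / (z - 1) \<notin> \<real>\<^sub>\<le>\<^sub>0"
  proof
    assume "(z + 1) / (z - 1) \<in> \<real>\<^sub>\<le>\<^sub>0"
    then obtain t where t: "t \<le> 0" "(z + 1) / (z - 1) = of_real t" by (auto elim: nonpos_Reals_cases)
    have "z \<noteq> 1" using assms by (auto simp: legendre_cut_plane_iff)
    then have "z + 1 = of_real t * (z - 1)" using t(2) by (simp add: field_simps)
    then have "z * of_real (t - 1) = of_real (t + 1)" by (simp add: algebra_simps)
    then have "z = of_real ((t + 1) / (t - 1))" using t(1)
      by (metis diff_gt_0_iff_gt eq_divide_imp eq_iff_diff_eq_0 not_one_le_zero of_real_divide of_real_eq_0_iff)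
    moreover have "(t + 1) / (t - 1) \<le> 1" using t(1) by (simp add: divide_simps)
    ultimately show False using real by blast
  qed
qed

text \<open>The argument \<open>(1 - z) / 2\<close> is \<open>- sinh^2 (\<theta>/2)\<close>, so
  \<open>hyp2F1_half\<close> applies. The prefactor \<open>coth^(1/2) (\<theta>/2)\<close> turns the
  denominator \<open>cosh (\<theta>/2)\<close> into the square root of
  \<open>sinh (\<theta>/2) cosh (\<theta>/2)\<close>.\<close>

lemma legendreP_half:
  fixes c :: real
  assumes "z \<in> legendre_cut_plane"
  shows "legendreP (of_real c - 1 / 2) (1 / 2) z =
    1 / (2 * Gamma (1 / 2)) * legendre_exp (of_real c) z + 1 / (2 * Gamma (1 / 2)) * legendre_exp (- of_real c) z"
  using _ _ _ assms
proof (rule holomorphic_eq_of_real_cut_plane)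
  note args = legendre_cut_plane_arguments
  have P: "legendreP (of_real c - 1 / 2) (1 / 2) z = 1 / Gamma (1 / 2) * ((z + 1) / (z - 1)) powr (1 / 4) *
     hyp2F1 (1 / 2 - of_real c) (of_real c + 1 / 2) (1 / 2) ((1 - z) / 2)" for z
  proof -
    have "- (of_real c - 1 / 2) = (1 / 2 - of_real c :: complex)" "of_real c - 1 / 2 + 1 = (of_real c + 1 / 2 :: complex)"
      "1 - 1 / 2 = (1 / 2 :: complex)" "1 / 2 / 2 = (1 / 4 :: complex)" by simp_all
    then show ?thesis by (simp only: legendreP_def)
  qed
  have "(\<lambda>z. hyp2F1 (1 / 2 - of_real c) (of_real c + 1 / 2) (1 / 2) ((1 - z) / 2)) holomorphic_on legendre_cut_plane"
    by (rule holomorphic_on_compose_gen[OF _ hyp2F1_half_holomorphic, unfolded o_def])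
       (use args in \<open>auto intro!: holomorphic_intros\<close>)
  moreover have "(\<lambda>z. ((z + 1) / (z - 1)) powr (1 / 4)) holomorphic_on legendre_cut_plane"
    using args(3) by (intro holomorphic_intros) (auto simp: legendre_cut_plane_iff)
  ultimately have "(\<lambda>z. 1 / Gamma (1 / 2) * ((z + 1) / (z - 1)) powr (1 / 4) *
     hyp2F1 (1 / 2 - of_real c) (of_real c + 1 / 2) (1 / 2) ((1 - z) / 2)) holomorphic_on legendre_cut_plane"
    by (intro holomorphic_on_mult holomorphic_on_const)
  then show "legendreP (of_real c - 1 / 2) (1 / 2) holomorphic_on legendre_cut_plane"
    by (simp only: P[abs_def])
  show "(\<lambda>z. 1 / (2 * Gamma (1 / 2)) * legendre_exp (of_real c) z + 1 / (2 * Gamma (1 / 2)) * legendre_exp (- of_real c) z)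
      holomorphic_on legendre_cut_plane"
    by (intro holomorphic_intros legendre_exp_holomorphic)
  fix x :: real assume x: "x > 1"
  define A B where "A = (x - 1) / 2" and "B = (x + 1) / 2"
  have AB: "A > 0" "B > 0" using x by (auto simp: A_def B_def)
  define L where "L = ln (sqrt A + sqrt B)"
  have s: "sqrt A + sqrt B > 0" using AB by (simp add: add_pos_pos)
  have w: "- ((1 - of_real x) / 2) = complex_of_real A" "1 - (1 - of_real x) / 2 = complex_of_real B"
    by (simp_all add: A_def B_def field_simps)
  have h: "hyp_exp (of_real d) ((1 - of_real x) / 2) = of_real (exp (2 * d * L) / sqrt B)" for d
  proof -
    have "hyp_exp (of_real d) ((1 - of_real x) / 2) =
        exp (2 * of_real d * Ln (of_real (sqrt A + sqrt B))) / of_real (sqrt B)"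
      unfolding hyp_exp_def w using AB by (simp add: csqrt_of_real)
    then show ?thesis unfolding Ln_of_real[OF s] L_def by (simp flip: exp_of_real)
  qed
  have x': "of_real x \<in> legendre_cut_plane" using x by (simp add: legendre_cut_plane_iff)
  have "((of_real x + 1) / (of_real x - 1)) = complex_of_real (B / A)"
  proof -
    have "of_real x + 1 = complex_of_real (2 * B)" "of_real x - 1 = complex_of_real (2 * A)"
      by (simp_all add: A_def B_def)
    moreover have "complex_of_real (2 * B) / complex_of_real (2 * A) = of_real (B / A)" by simp
    ultimately show ?thesis by (simp only:)
  qed
  also have "\<dots> powr (1 / 4) = of_real ((B / A) powr (1 / 4))"
    using powr_of_real[of "B / A" "1 / 4"] AB by simp
  finally have p: "((of_real x + 1) / (of_real x - 1)) powr (1 / 4) = complex_of_real ((B / A) powr (1 / 4))" .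
  have r: "(B / A) powr (1 / 4) * (exp t / sqrt B) = exp (t - (ln A + ln B) / 4)" for t
  proof -
    have "sqrt B = exp (ln B / 2)" using AB by (simp add: powr_half_sqrt[symmetric] powr_def)
    moreover have "(B / A) powr (1 / 4) = exp ((ln B - ln A) / 4)" using AB by (simp add: powr_def ln_div)
    ultimately show ?thesis by (simp add: exp_add[symmetric] exp_diff[symmetric] field_simps)
  qed
  have e: "legendre_exp (of_real d) (of_real x) = of_real ((B / A) powr (1 / 4) * (exp (2 * d * L) / sqrt B))" for d
    unfolding legendre_exp_of_real[OF x] A_def[symmetric] B_def[symmetric] L_def[symmetric] r ..
  show "legendreP (of_real c - 1 / 2) (1 / 2) (of_real x) =
      1 / (2 * Gamma (1 / 2)) * legendre_exp (of_real c) (of_real x) + 1 / (2 * Gamma (1 / 2)) * legendre_exp (- of_real c) (of_real x)"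
  proof -
    have "1 / G * R * ((u + v) / 2) = 1 / (2 * G) * (R * u) + 1 / (2 * G) * (R * v)" for G R u v :: complex
      by (simp add: distrib_left add_divide_distrib mult.commute[of G 2])
    then show ?thesis
      unfolding P hyp2F1_half[OF args(1)[OF x']] p of_real_minus[symmetric] e h unfolding of_real_mult .
  qed
qed

text \<open>At \<open>\<mu> = 1/2\<close> the numbers \<open>\<nu> + \<mu> + 1\<close> and
  \<open>\<nu> + 3/2\<close> are both \<open>c + 1\<close>, which brings the function into the form
  of \<open>hyp2F1_shifted_half\<close>. \<open>K\<close> keeps the equal Gamma factors so as to
  match the definition literally.\<close>

lemma legendreQ_half:
  fixes c :: real
  assumes c: "c > 0" and "z \<in> legendre_cut_plane"
  defines "K \<equiv> exp (1 / 2 * of_real pi * \<i>) * of_real (sqrt pi) * Gamma (of_real c + 1) / (2 powr (of_real c + 1 / 2) * Gamma (of_real c + 1))"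
  shows "legendreQ (of_real c - 1 / 2) (1 / 2) z = K * of_real (exp ((c - 1 / 2) * ln 2)) * legendre_exp (- of_real c) z"
  using _ _ _ assms(2)
proof (rule holomorphic_eq_of_real_cut_plane)
  note args = legendre_cut_plane_arguments
  have c': "of_real c + 1 + of_nat m \<noteq> (0 :: complex)" for m
  proof -
    have "Re (of_real c + 1 + of_nat m) > 0" using c by simp
    then show ?thesis by (metis less_irrefl zero_complex.sel(1))
  qed
  have Q: "legendreQ (of_real c - 1 / 2) (1 / 2) z = K *
     ((z - 1) powr (1 / 4) * (z + 1) powr (1 / 4)) / z powr (of_real c + 1) *
     hyp2F1 ((of_real c + 2) / 2) ((of_real c + 1) / 2) (of_real c + 1) (1 / z\<^sup>2)" for z
  proof -
    have "of_real c - 1 / 2 + 1 / 2 + 2 = (of_real c + 2 :: complex)" "of_real c - 1 / 2 + 1 / 2 + 1 = (of_real c + 1 :: complex)"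
      "of_real c - 1 / 2 + 1 = (of_real c + 1 / 2 :: complex)" "of_real c - 1 / 2 + 3 / 2 = (of_real c + 1 :: complex)"
      "1 / 2 / 2 = (1 / 4 :: complex)" by simp_all
    then show ?thesis by (simp only: legendreQ_def K_def)
  qed
  have "(\<lambda>z. hyp2F1 ((of_real c + 2) / 2) ((of_real c + 1) / 2) (of_real c + 1) (1 / z\<^sup>2)) holomorphic_on legendre_cut_plane"
    by (rule holomorphic_on_compose_gen[OF _ hyp2F1_shifted_half_holomorphic[OF c'], unfolded o_def])
       (use args in \<open>auto intro!: holomorphic_intros\<close>)
  moreover have "(\<lambda>z. (z - 1) powr (1 / 4) * (z + 1) powr (1 / 4) / z powr (of_real c + 1)) holomorphic_on legendre_cut_plane"
    using args(4-6) legendre_cut_plane_nonpos(3) by (intro holomorphic_intros) auto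
  ultimately have "(\<lambda>z. K * ((z - 1) powr (1 / 4) * (z + 1) powr (1 / 4) / z powr (of_real c + 1)) *
     hyp2F1 ((of_real c + 2) / 2) ((of_real c + 1) / 2) (of_real c + 1) (1 / z\<^sup>2)) holomorphic_on legendre_cut_plane"
    by (intro holomorphic_on_mult holomorphic_on_const)
  then show "legendreQ (of_real c - 1 / 2) (1 / 2) holomorphic_on legendre_cut_plane"
    by (simp only: Q[abs_def] times_divide_eq_right)
  show "(\<lambda>z. K * of_real (exp ((c - 1 / 2) * ln 2)) * legendre_exp (- of_real c) z) holomorphic_on legendre_cut_plane"
    by (intro holomorphic_intros legendre_exp_holomorphic)
  fix x :: real assume x: "x > 1"
  define A B where "A = (x - 1) / 2" and "B = (x + 1) / 2"
  have AB: "A > 0" "B > 0" using x by (auto simp: A_def B_def)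
  define q where "q = sqrt (1 - 1 / x\<^sup>2)"
  have q: "q > 0" using x by (simp add: q_def)
  have xq: "x * q = 2 * (sqrt A * sqrt B)"
  proof (rule power2_eq_imp_eq)
    have "(x * q)\<^sup>2 = x\<^sup>2 - 1" using x by (simp add: q_def power_mult_distrib field_simps)
    moreover have "(2 * (sqrt A * sqrt B))\<^sup>2 = x\<^sup>2 - 1"
      using AB by (simp add: power_mult_distrib) (simp add: A_def B_def field_simps power2_eq_square)
    ultimately show "(x * q)\<^sup>2 = (2 * (sqrt A * sqrt B))\<^sup>2" by simp
  qed (use x q AB in auto)
  \<comment> \<open>For \<open>x = cosh \<theta>\<close>, \<open>x q\<close> is
    \<open>sinh \<theta>\<close> and this is \<open>exp \<theta>\<close>.\<close>
  have x1q: "x * (1 + q) = (sqrt A + sqrt B)\<^sup>2"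
    using xq AB by (simp add: power2_sum distrib_left) (simp add: A_def B_def field_simps)
  have s: "sqrt A + sqrt B > 0" using AB by (simp add: add_pos_pos)
  have sq: "sqrt A = exp (ln A / 2)" "sqrt B = exp (ln B / 2)" 
    using AB by (simp_all add: powr_half_sqrt[symmetric] powr_def)
  have lq: "ln q = ln 2 + (ln A + ln B) / 2 - ln x"
  proof -
    have "ln x + ln q = ln (2 * (sqrt A * sqrt B))" unfolding xq[symmetric] using x q by (simp add: ln_mult)
    also have "\<dots> = ln 2 + (ln A + ln B) / 2" using AB by (simp add: ln_mult ln_sqrt)
    finally show ?thesis by simp
  qed
  have l1q: "ln (1 + q) = 2 * ln (sqrt A + sqrt B) - ln x"
  proof -
    have "ln x + ln (1 + q) = ln ((sqrt A + sqrt B)\<^sup>2)" unfolding x1q[symmetric] using x q by (simp add: ln_mult)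
    also have "\<dots> = 2 * ln (sqrt A + sqrt B)" using s by (simp add: ln_realpow)
    finally show ?thesis by simp
  qed
  have lx: "ln (x - 1) = ln 2 + ln A" "ln (x + 1) = ln 2 + ln B"
  proof -
    have "x - 1 = 2 * A" "x + 1 = 2 * B" by (simp_all add: A_def B_def)
    note eq = this
    show "ln (x - 1) = ln 2 + ln A" "ln (x + 1) = ln 2 + ln B" unfolding eq using AB by (simp_all add: ln_mult)
  qed
  have w: "1 - 1 / (of_real x)\<^sup>2 = complex_of_real (1 - 1 / x\<^sup>2)" by simp
  have cq: "csqrt (1 - 1 / (of_real x)\<^sup>2) = of_real q"
    unfolding w q_def using x by (intro csqrt_of_real) simp
  have x': "of_real x \<in> legendre_cut_plane" using x by (simp add: legendre_cut_plane_iff)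
  have h: "hyp2F1 ((of_real c + 2) / 2) ((of_real c + 1) / 2) (of_real c + 1) (1 / (of_real x)\<^sup>2) =
      of_real (exp (c * (ln 2 - ln (1 + q)) - ln q))"
  proof -
    have "hyp2F1 ((of_real c + 2) / 2) ((of_real c + 1) / 2) (of_real c + 1) (1 / (of_real x)\<^sup>2) =
        exp (of_real c * (Ln (of_real 2) - Ln (of_real (1 + q)))) / of_real q"
      unfolding hyp2F1_shifted_half[OF args(2)[OF x'] c'] cq by simp
    also have "\<dots> = of_real (exp (c * (ln 2 - ln (1 + q))) / q)"
      using q by (subst (1 2) Ln_of_real) (auto simp flip: exp_of_real)
    also have "exp (c * (ln 2 - ln (1 + q))) / q = exp (c * (ln 2 - ln (1 + q)) - ln q)"
      using q by (simp add: exp_diff)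
    finally show ?thesis .
  qed
  have pw: "complex_of_real t powr of_real d = of_real (exp (d * ln t))" if "t > 0" for t d
    using that powr_of_real[of t d] by (simp add: powr_def)
  have p: "(of_real x - 1) powr (1 / 4) = complex_of_real (exp (1 / 4 * ln (x - 1)))"
      "(of_real x + 1) powr (1 / 4) = complex_of_real (exp (1 / 4 * ln (x + 1)))"
      "of_real x powr (of_real c + 1) = complex_of_real (exp ((c + 1) * ln x))"
    using pw[of "x - 1" "1 / 4"] pw[of "x + 1" "1 / 4"] pw[of x "c + 1"] x by simp_all
  \<comment> \<open>The powers of \<open>x\<close> cancel. The exponent of \<open>2\<close> is
    \<open>c\<close> from the hypergeometric factor, \<open>1/2\<close> from the two quarter powers
    and \<open>- 1\<close> from \<open>ln q\<close>.\<close>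
  have e: "exp (1 / 4 * ln (x - 1)) * exp (1 / 4 * ln (x + 1)) / exp ((c + 1) * ln x) * exp (c * (ln 2 - ln (1 + q)) - ln q) =
      exp ((c - 1 / 2) * ln 2) * exp (2 * - c * ln (sqrt A + sqrt B) - (ln A + ln B) / 4)"
    unfolding exp_add[symmetric] exp_diff[symmetric] lx l1q lq exp_inj_iff by (simp add: field_simps)
  have "legendreQ (of_real c - 1 / 2) (1 / 2) (of_real x) = K * of_real
      (exp (1 / 4 * ln (x - 1)) * exp (1 / 4 * ln (x + 1)) / exp ((c + 1) * ln x) * exp (c * (ln 2 - ln (1 + q)) - ln q))"
    unfolding Q p h by simp
  also have "\<dots> = K * of_real (exp ((c - 1 / 2) * ln 2)) * legendre_exp (- of_real c) (of_real x)"
    unfolding e using legendre_exp_of_real[OF x, of "- c"] by (simp add: A_def B_def)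
  finally show "legendreQ (of_real c - 1 / 2) (1 / 2) (of_real x) =
      K * of_real (exp ((c - 1 / 2) * ln 2)) * legendre_exp (- of_real c) (of_real x)" .
qed

lemma legendre_pair_principal:
  fixes c :: real
  assumes c: "c > 0" and \<nu>: "\<nu> = of_real c - 1 / 2"
  obtains K where "K \<noteq> 0" "legendre_pair_on \<nu> (1 / 2) K legendre_cut_plane (legendreP \<nu> (1 / 2)) (legendreQ \<nu> (1 / 2))"
proof -
  define A :: complex where "A = 1 / (2 * Gamma (1 / 2))"
  define B where "B = exp (1 / 2 * of_real pi * \<i>) * of_real (sqrt pi) * Gamma (of_real c + 1) /
    (2 powr (of_real c + 1 / 2) * Gamma (of_real c + 1)) * of_real (exp ((c - 1 / 2) * ln 2))"
  \<comment> \<open>\<open>Gamma\<close> is \<open>0\<close> at its poles by convention, so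
    positivity of \<open>c + 1\<close> is used to cancel the quotient.\<close>
  have G: "Gamma (complex_of_real c + 1) \<noteq> 0"
  proof -
    have "Gamma (c + 1) \<noteq> 0" using Gamma_real_pos[of "c + 1"] c by linarith
    then have "Gamma (complex_of_real (c + 1)) \<noteq> 0" by (simp only: Gamma_complex_of_real of_real_eq_0_iff not_False_eq_True)
    then show ?thesis by simp
  qed
  then have B: "B \<noteq> 0" by (simp add: B_def)
  have A: "A \<noteq> 0" by (simp add: A_def Gamma_one_half_complex)
  have "legendre_pair_on \<nu> (1 / 2) (- 4 * of_real c * A * B) legendre_cut_plane (legendreP \<nu> (1 / 2)) (legendreQ \<nu> (1 / 2))"
    by (rule legendre_pair_on_cong[OF legendre_pair_legendre_exp[OF \<nu>, of A B] open_legendre_cut_plane order_refl])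
       (simp_all only: \<nu> legendreP_half legendreQ_half[OF c] A_def B_def)
  then show ?thesis using A B c by (intro that[of "- 4 * of_real c * A * B"]) auto
qed

subsection \<open>The homogeneous equation\<close>

lemma solves_ode_with_rhs_cong:
  assumes "solves_ode_with_rhs n a g U F" "open U" "\<And>x. x \<in> U \<Longrightarrow> G x = F x"
  shows "solves_ode_with_rhs n a g U G"
proof -
  have d: "deriv G x = deriv F x" if "x \<in> U" for x
    by (rule deriv_eq_on_open[OF assms(2,3) that])
  have "deriv (deriv G) x = deriv (deriv F) x" if "x \<in> U" for x
    by (rule deriv_eq_on_open[OF assms(2) d that])
  moreover have "G holomorphic_on U"
    using assms(1) unfolding solves_ode_with_rhs_def
    by (intro holomorphic_transform[of F U G]) (simp_all add: assms(3))
  ultimately show ?thesis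
    using assms(1,3) d by (simp add: solves_ode_with_rhs_def)
qed

text \<open>Both branches are transported by the substitution to solutions on \<open>U\<close>.
  Their Wronskian is that of \<open>P\<close> and \<open>Q\<close> times a nonvanishing factor, so
  they form a fundamental pair.\<close>

lemma solves_homogeneous_ode_iff_legendre:
  assumes "a \<noteq> 0" and s: "s\<^sup>2 = a" and U: "open U" "connected U" "U \<subseteq> dickson_domain a"
    and branch: "legendre_branch (of_real (sqrt ((real n)\<^sup>2 + 1) - 1 / 2)) (1 / 2) P Q T"
    and T: "(\<lambda>x. x / (2 * s)) ` U \<subseteq> T"
    and r: "r holomorphic_on U" "\<forall>x\<in>U. r x ^ 4 = x\<^sup>2 - 4 * a"
  shows "solves_homogeneous_ode n a U Fc \<longleftrightarrow>
    (\<exists>A B. \<forall>x\<in>U. Fc x = 1 / r x * (A * P (x / (2 * s)) + B * Q (x / (2 * s))))"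
proof -
  define c where "c = sqrt ((real n)\<^sup>2 + 1)"
  define \<nu> where "\<nu> = complex_of_real c - 1 / 2"
  have c: "c > 0" unfolding c_def by (simp add: add_nonneg_pos)
  have c2: "(complex_of_real c)\<^sup>2 = (of_nat n)\<^sup>2 + 1"
  proof -
    have "c\<^sup>2 = (real n)\<^sup>2 + 1" by (simp add: c_def)
    then have "complex_of_real (c\<^sup>2) = of_real ((real n)\<^sup>2 + 1)" by (rule arg_cong)
    then show ?thesis by simp
  qed
  have \<nu>2: "\<nu> * (\<nu> + 1) = (of_nat n)\<^sup>2 + 3 / 4"
  proof -
    have "\<nu> * (\<nu> + 1) = (of_real c)\<^sup>2 - 1 / 4" by (simp add: \<nu>_def field_simps power2_eq_square)
    then show ?thesis unfolding c2 by simp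
  qed
  have s0: "s \<noteq> 0" using s assms(1) by auto
  have br: "legendre_branch \<nu> (1 / 2) P Q T" using branch by (simp add: \<nu>_def c_def)
  have oT: "open T" by (rule legendre_branch_open[OF br])
  obtain K where K: "K \<noteq> 0"
    "legendre_pair_on \<nu> (1 / 2) K legendre_cut_plane (legendreP \<nu> (1 / 2)) (legendreQ \<nu> (1 / 2))"
    using legendre_pair_principal[OF c \<nu>_def] by blast
  have pair: "legendre_pair_on \<nu> (1 / 2) K T P Q" by (rule legendre_branch_pair[OF br K(2)])
  have leg: "legendre_equation_on \<nu> (1 / 2) T P" "legendre_equation_on \<nu> (1 / 2) T Q"
    using pair by (auto simp: legendre_pair_on_def)
  then have hol: "P holomorphic_on T" "Q holomorphic_on T" by (auto simp: legendre_equation_on_def)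
  have U': "x\<^sup>2 \<noteq> 4 * a" if "x \<in> U" for x using U(3) that by (auto simp: dickson_domain_eq[OF assms(1)])
  have r': "r x ^ 4 = x\<^sup>2 - 4 * a" if "x \<in> U" for x using r(2) that by blast
  let ?G = "\<lambda>g x. 1 / r x * g (x / (2 * s))"
  have sol: "solves_homogeneous_ode n a U (?G g)" if "legendre_equation_on \<nu> (1 / 2) T g" for g
    by (rule solves_homogeneous_ode_substitution[OF U(1) oT s0 s T r(1) r' U' that \<nu>2])
  show ?thesis
  proof
    assume Fc: "solves_homogeneous_ode n a U Fc"
    have W: "?G P x * deriv (?G Q) x - deriv (?G P) x * ?G Q x \<noteq> 0" if x: "x \<in> U" for x
    proof -
      define z where "z = x / (2 * s)"
      have z: "z \<in> T" using T x by (auto simp: z_def)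
      have r0: "r x \<noteq> 0" using r'[OF x] U'[OF x] by auto
      have d: "deriv (?G g) x = 1 / r x * (deriv g z / (2 * s) - x / (2 * (x\<^sup>2 - 4 * a)) * g z)"
        if "g holomorphic_on T" for g
        unfolding z_def
        by (rule DERIV_imp_deriv, rule DERIV_legendre_substitution[OF U(1) oT s0 T that r(1) r' x U'[OF x]])
      \<comment> \<open>The terms from the derivative of \<open>1 / r\<close> are the same multiple
        \<open>k\<close> of both functions and drop out of the Wronskian.\<close>
      have "R * u * (R * (v' / t - k * v)) - R * (u' / t - k * u) * (R * v) = R\<^sup>2 / t * (u * v' - u' * v)"
        for R u v u' v' k t :: complex
        by (simp add: algebra_simps diff_divide_distrib power2_eq_square)
      then have "?G P x * deriv (?G Q) x - deriv (?G P) x * ?G Q x =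
          (1 / r x)\<^sup>2 / (2 * s) * (P z * deriv Q z - deriv P z * Q z)"
        unfolding d[OF hol(1)] d[OF hol(2)] z_def[symmetric] .
      moreover have "(z\<^sup>2 - 1) * (P z * deriv Q z - deriv P z * Q z) = K"
        using pair z by (simp add: legendre_pair_on_def)
      then have "P z * deriv Q z - deriv P z * Q z \<noteq> 0" using K(1) by (metis mult_zero_right)
      ultimately show ?thesis using r0 s0 by simp
    qed
    have ode: "(x\<^sup>2 - 4 * a) * deriv (deriv f) x + 3 * x * deriv f x + - (of_nat n)\<^sup>2 * f x = 0"
      if "solves_homogeneous_ode n a U f" "x \<in> U" for f x
      using that by (simp add: solves_ode_with_rhs_def)
    have hol_sol: "f holomorphic_on U" if "solves_homogeneous_ode n a U f" for f
      using that by (simp add: solves_ode_with_rhs_def)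
    have "\<exists>A B. \<forall>x\<in>U. Fc x = A * ?G P x + B * ?G Q x"
    proof (rule second_order_ode_fundamental_pair[OF U(1,2)])
      show "x\<^sup>2 - 4 * a \<noteq> 0" if "x \<in> U" for x using U'[OF that] by simp
    qed (rule ode hol_sol W Fc sol leg; assumption?)+
    then show "\<exists>A B. \<forall>x\<in>U. Fc x = 1 / r x * (A * P (x / (2 * s)) + B * Q (x / (2 * s)))"
      by (simp add: algebra_simps)
  next
    assume "\<exists>A B. \<forall>x\<in>U. Fc x = 1 / r x * (A * P (x / (2 * s)) + B * Q (x / (2 * s)))"
    then obtain A B where AB: "\<And>x. x \<in> U \<Longrightarrow> Fc x = ?G (\<lambda>z. A * P z + B * Q z) x" by blast
    have "solves_homogeneous_ode n a U (?G (\<lambda>z. A * P z + B * Q z))"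
      by (rule sol[OF legendre_equation_on_linear[OF leg oT]])
    then show "solves_homogeneous_ode n a U Fc"
      by (rule solves_ode_with_rhs_cong[OF _ U(1) AB])
  qed
qed

text \<open>The last clause is the one before it applied to the difference of
  \<open>dickson3 n a\<close> and \<open>p\<close>, which solves the homogeneous equation
  identically and hence on every \<open>U\<close>.\<close>

theorem theorem1p2:
  fixes n :: nat and a :: complex
  assumes "a \<noteq> 0"
  shows "solves_dickson_ode n a (dickson_domain a) (poly (dickson3 n a)) \<and>
    (\<exists>p. solves_dickson_ode n a (dickson_domain a) (poly p)) \<and>
    (\<forall>p. solves_dickson_ode n a (dickson_domain a) (poly p) \<longleftrightarrow>
       (\<exists>b. (\<forall>k>n. b k = 0) \<and> dickson3_recurrence n a b \<and> (\<forall>x. poly p x = (\<Sum>k=0..n. b k * x ^ k)))) \<and>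
    (\<forall>s U T P Q r.
       s\<^sup>2 = a \<and> open U \<and> connected U \<and> U \<subseteq> dickson_domain a \<and>
       legendre_branch (of_real (sqrt ((real n)\<^sup>2 + 1) - 1 / 2)) (1 / 2) P Q T \<and>
       (\<lambda>x. x / (2 * s)) ` U \<subseteq> T \<and>
       r holomorphic_on U \<and> (\<forall>x\<in>U. r x ^ 4 = x\<^sup>2 - 4 * a) \<longrightarrow>
       (\<forall>Fc. solves_homogeneous_ode n a U Fc \<longleftrightarrow>
          (\<exists>A B. \<forall>x\<in>U. Fc x = 1 / r x * (A * P (x / (2 * s)) + B * Q (x / (2 * s))))) \<and>
       (\<forall>p. solves_dickson_ode n a (dickson_domain a) (poly p) \<longrightarrow>
          (\<exists>A B. \<forall>x\<in>U. poly (dickson3 n a) x =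
             1 / r x * (A * P (x / (2 * s)) + B * Q (x / (2 * s))) + poly p x)))"
proof -
  have F: "solves_dickson_ode n a (dickson_domain a) (poly (dickson3 n a))"
    by (simp add: solves_dickson_ode_poly_iff[OF assms] dickson_operator_dickson3)
  have rec: "solves_dickson_ode n a (dickson_domain a) (poly p) \<longleftrightarrow>
       (\<exists>b. (\<forall>k>n. b k = 0) \<and> dickson3_recurrence n a b \<and> (\<forall>x. poly p x = (\<Sum>k=0..n. b k * x ^ k)))" for p
    unfolding solves_dickson_ode_poly_iff[OF assms] by (rule dickson_operator_eq_iff_recurrence[OF assms])
  have gen: "solves_homogeneous_ode n a U Fc \<longleftrightarrow>
      (\<exists>A B. \<forall>x\<in>U. Fc x = 1 / r x * (A * P (x / (2 * s)) + B * Q (x / (2 * s))))"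
    if "s\<^sup>2 = a" "open U" "connected U" "U \<subseteq> dickson_domain a"
      "legendre_branch (of_real (sqrt ((real n)\<^sup>2 + 1) - 1 / 2)) (1 / 2) P Q T"
      "(\<lambda>x. x / (2 * s)) ` U \<subseteq> T" "r holomorphic_on U" "\<forall>x\<in>U. r x ^ 4 = x\<^sup>2 - 4 * a"
    for s U T P Q r Fc
    by (rule solves_homogeneous_ode_iff_legendre[OF assms that])
  have diff: "\<exists>A B. \<forall>x\<in>U. poly (dickson3 n a) x = 1 / r x * (A * P (x / (2 * s)) + B * Q (x / (2 * s))) + poly p x"
    if h: "s\<^sup>2 = a" "open U" "connected U" "U \<subseteq> dickson_domain a"
      "legendre_branch (of_real (sqrt ((real n)\<^sup>2 + 1) - 1 / 2)) (1 / 2) P Q T"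
      "(\<lambda>x. x / (2 * s)) ` U \<subseteq> T" "r holomorphic_on U" "\<forall>x\<in>U. r x ^ 4 = x\<^sup>2 - 4 * a"
      and p: "solves_dickson_ode n a (dickson_domain a) (poly p)"
    for s U T P Q r p
  proof -
    have "dickson_operator n a (dickson3 n a - p) = dickson_operator n a (dickson3 n a) - dickson_operator n a p"
      by (rule poly_eqI) (simp only: coeff_diff coeff_dickson_operator, simp add: algebra_simps)
    also have "\<dots> = 0"
      using F p unfolding solves_dickson_ode_poly_iff[OF assms] by simp
    finally have "solves_homogeneous_ode n a U (poly (dickson3 n a - p))"
      unfolding solves_ode_poly_iff by simp
    then obtain A B where "\<forall>x\<in>U. poly (dickson3 n a - p) x = 1 / r x * (A * P (x / (2 * s)) + B * Q (x / (2 * s)))"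
      unfolding gen[OF h] by blast
    then have "\<forall>x\<in>U. poly (dickson3 n a) x = 1 / r x * (A * P (x / (2 * s)) + B * Q (x / (2 * s))) + poly p x"
      unfolding poly_diff by (simp only: diff_eq_eq)
    then show ?thesis by blast
  qed
  show ?thesis
  proof (intro conjI allI impI)
    show "\<exists>p. solves_dickson_ode n a (dickson_domain a) (poly p)" using F by blast
  qed (rule F rec gen diff; elim conjE; assumption)+
qed

end
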